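(* Let $n\geq 5$. There exist $\delta>0$ and $\rho>0$ such that, for every convex $n$-gon $D$ whose vertex tuple $a=(A_1,\dots,A_n)$ satisfies $|a-a^*|<\delta$, the following hold. (i) There exists a unique admissible proportional system $\{T_i\}_{i=1}^n$ for $D$ whose apices $V_i$ all satisfy $|V_i|<\rho$ (i.e. which is close to the fundamental system of $D^*$) and whose associated system of weights $\{p_i\}$ satisfies $p_n=1$; consequently this system covers $D$: $\bigcup_{i=1}^n T_i\supseteq D$. (ii) As $a\to a^*$, this covering converges to the fundamental covering of $D^*$ by isosceles triangles, namely for every $i=1,\dots,n$ the apex $V_i$ of $T_i$ converges to $0$. (iii) The cells $$Q_i:=\{x\in D:\ p_i\,d(x,q_i)\le p_j\,d(x,q_j)\ \ \forall j\},\qquad i=1,\dots,n,$$ are convex polygons satisfying $Q_i\subseteq T_i$, containing the whole base $[A_i,A_{i+1}]$ of $T_i$, and partitioning $D$ (i.e. they cover $D$ and have pairwise disjoint interiors).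
   Context: Polygons and triangles are closed. Let $D$ be a convex $n$-gon with vertices $A_1,\dots,A_n$ enumerated counterclockwise; indices of vertices, triangles, lines and rays are understood modulo $n$ ($A_{n+1}=A_1$, $A_0=A_n$, and likewise for $T_i,q_i,\ell_i$). Regular polygon: $D^*$ is the regular $n$-gon with vertex tuple $a^*=(A_1^*,\dots,A_n^* )$, $A_i^*=(\cos\frac{2\pi i}{n},\sin\frac{2\pi i}{n})$. Its fundamental system consists of the isosceles triangles with vertices $A_i^*,A_{i+1}^*,0$. Admissible system: a family of triangles $\{T_i\}_{i=1}^n$ is an admissible system for $D$ if, for every $i$, $T_i\cap D\ne\emptyset$, $T_i$ has base $[A_i,A_{i+1}]$, and $T_i$ and $T_{i+1}$ share a boundary segment which is an entire side of at least one of these two triangles. The apex $V_i$ of $T_i$ is its vertex opposite to $[A_i,A_{i+1}]$, and $\alpha_i$ is the angle of $T_i$ at $V_i$. The system is proportional if the ratio $\alpha_i/|T_i|$ ($|T_i|$ = area) is independent of $i$. Weights: given an admissible proportional system, let $\ell_i$ be the ray emanating from $A_i$ such that, for each $i$, the triangle $T_i$ with base $[A_i,A_{i+1}]$ has its other two sides on $\ell_i$ and $\ell_{i+1}$. Let $q_i$ be the straight line containing $[A_i,A_{i+1}]$ and $d(\cdot,q_i)$ the distance from it. The weights are defined by $p_0=1$ and, for $i=1,\dots,n$, $$p_i=p_{i-1}\,\frac{d(z,q_{i-1})}{d(z,q_i)}\qquad\text{for any } z\in\ell_i\setminus\{A_i\},$$ the quotient being independent of the choice of $z$. *)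

theory Defs
  imports "HOL-Analysis.Analysis"
begin

text \<open>
  The plane is \<^typ>\<open>complex\<close>. Families indexed modulo \<open>n\<close> (vertices, apices) are functions
  on \<^typ>\<open>nat\<close> of period \<open>n\<close>; thus index \<open>0\<close> is the same as \<open>n\<close>, and index \<open>n + 1\<close> the same
  as \<open>1\<close>. In particular, equality of two such functions is equality of the \<open>n\<close>-tuples.
\<close>

definition periodic :: "nat \<Rightarrow> (nat \<Rightarrow> 'a) \<Rightarrow> bool" where
  "periodic n f \<longleftrightarrow> (\<forall>i. f (i + n) = f i)"

definition polygon_of :: "nat \<Rightarrow> (nat \<Rightarrow> complex) \<Rightarrow> complex set" where
  "polygon_of n A = convex hull (A ` {1..n})"

text \<open>
  The vertices are distinct and are the extreme points of the polygon. Since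
  \<open>Im (cnj u * v)\<close> is the determinant of \<open>(u, v)\<close>, the last clause says that the polygon lies to
  the left of each directed line from \<open>A i\<close> to \<open>A (i + 1)\<close>: consecutive vertices span the edges
  and the enumeration is counterclockwise.
\<close>

definition convex_ngon :: "nat \<Rightarrow> (nat \<Rightarrow> complex) \<Rightarrow> bool" where
  "convex_ngon n A \<longleftrightarrow> 3 \<le> n \<and> periodic n A \<and> inj_on A {1..n} \<and>
     (\<forall>i. A i extreme_point_of polygon_of n A) \<and>
     (\<forall>i. \<forall>x\<in>polygon_of n A. 0 \<le> Im (cnj (A (Suc i) - A i) * (x - A i)))"

definition regular_vertex :: "nat \<Rightarrow> nat \<Rightarrow> complex" where
  "regular_vertex n i =
     Complex (cos (2 * pi * real i / real n)) (sin (2 * pi * real i / real n))"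

definition tuple_dist :: "nat \<Rightarrow> (nat \<Rightarrow> complex) \<Rightarrow> (nat \<Rightarrow> complex) \<Rightarrow> real" where
  "tuple_dist n A B = L2_set (\<lambda>i. dist (A i) (B i)) {1..n}"

definition tri_sides :: "complex \<Rightarrow> complex \<Rightarrow> complex \<Rightarrow> complex set set" where
  "tri_sides P Q R = {closed_segment P Q, closed_segment Q R, closed_segment R P}"

definition vertex_angle :: "complex \<Rightarrow> complex \<Rightarrow> complex \<Rightarrow> real" where
  "vertex_angle P V Q = arccos (inner (P - V) (Q - V) / (norm (P - V) * norm (Q - V)))"

text \<open>A system of triangles with the prescribed bases is given by its apices \<open>V i\<close>.\<close>

definition tri :: "(nat \<Rightarrow> complex) \<Rightarrow> (nat \<Rightarrow> complex) \<Rightarrow> nat \<Rightarrow> complex set" where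
  "tri A V i = convex hull {A i, A (Suc i), V i}"

definition admissible :: "nat \<Rightarrow> (nat \<Rightarrow> complex) \<Rightarrow> (nat \<Rightarrow> complex) \<Rightarrow> bool" where
  "admissible n A V \<longleftrightarrow> periodic n V \<and>
     (\<forall>i. \<not> collinear {A i, A (Suc i), V i} \<and>
          tri A V i \<inter> polygon_of n A \<noteq> {} \<and>
          (\<exists>S \<in> tri_sides (A i) (A (Suc i)) (V i) \<union>
                 tri_sides (A (Suc i)) (A (Suc (Suc i))) (V (Suc i)).
             S \<subseteq> frontier (tri A V i) \<inter> frontier (tri A V (Suc i))))"

definition proportional :: "(nat \<Rightarrow> complex) \<Rightarrow> (nat \<Rightarrow> complex) \<Rightarrow> bool" where
  "proportional A V \<longleftrightarrow>
     (\<exists>c. \<forall>i. vertex_angle (A i) (V i) (A (Suc i)) / measure lebesgue (tri A V i) = c)"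

definition is_ray :: "complex \<Rightarrow> complex set \<Rightarrow> bool" where
  "is_ray P L \<longleftrightarrow> (\<exists>u. u \<noteq> 0 \<and> L = {P + t *\<^sub>R u | t. 0 \<le> t})"

definition ray_system ::
    "(nat \<Rightarrow> complex) \<Rightarrow> (nat \<Rightarrow> complex) \<Rightarrow> (nat \<Rightarrow> complex set) \<Rightarrow> bool" where
  "ray_system A V l \<longleftrightarrow>
     (\<forall>i. is_ray (A i) (l i) \<and>
          closed_segment (A i) (V i) \<subseteq> l i \<and>
          closed_segment (A (Suc i)) (V i) \<subseteq> l (Suc i))"

definition side_line :: "(nat \<Rightarrow> complex) \<Rightarrow> nat \<Rightarrow> complex set" where
  "side_line A i = affine hull {A i, A (Suc i)}"

text \<open>
  The rays, and hence the values \<open>p 0, ..., p n\<close>, are determined by \<open>A\<close> and \<open>V\<close>; the values of \<open>p\<close>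
  beyond \<open>n\<close> are irrelevant. Nothing forces \<open>p n = p 0\<close>.
\<close>

definition weights ::
    "nat \<Rightarrow> (nat \<Rightarrow> complex) \<Rightarrow> (nat \<Rightarrow> complex) \<Rightarrow> (nat \<Rightarrow> real) \<Rightarrow> bool" where
  "weights n A V p \<longleftrightarrow>
     (\<exists>l. ray_system A V l \<and> p 0 = 1 \<and>
        (\<forall>i\<in>{1..n}. \<forall>z\<in>l i - {A i}.
           p i = p (i - 1) * (infdist z (side_line A (i - 1)) / infdist z (side_line A i))))"

definition cell :: "nat \<Rightarrow> (nat \<Rightarrow> complex) \<Rightarrow> (nat \<Rightarrow> real) \<Rightarrow> nat \<Rightarrow> complex set" where
  "cell n A p i =
     {x \<in> polygon_of n A.
        \<forall>j\<in>{1..n}. p i * infdist x (side_line A i) \<le> p j * infdist x (side_line A j)}"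

definition convex_polygon :: "complex set \<Rightarrow> bool" where
  "convex_polygon P \<longleftrightarrow> polytope P \<and> interior P \<noteq> {}"

definition normalized_system ::
    "nat \<Rightarrow> real \<Rightarrow> (nat \<Rightarrow> complex) \<Rightarrow> (nat \<Rightarrow> complex) \<Rightarrow> bool" where
  "normalized_system n \<rho> A V \<longleftrightarrow>
     admissible n A V \<and> proportional A V \<and> (\<forall>i. norm (V i) < \<rho>) \<and>
     (\<exists>p. weights n A V p \<and> p n = 1)"

end

theory Submission
  imports Defs
begin

text \<open>
  Describe the ray at a vertex by the logarithm \<open>t\<^sub>j\<close> of the ratio of the distances of its points from
  the two adjacent side lines. Then \<open>p\<^sub>n = 1\<close> says that the \<open>t\<^sub>j\<close> have sum \<open>0\<close>, and the quotient of angle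
  and area of a triangle is a function \<open>G\<^sub>j(t\<^sub>j, t\<^sub>j\<^sub>+\<^sub>1)\<close>, strictly increasing in the first and strictly
  decreasing in the second argument, because both the apex angle and the reciprocal of the area are
  increasing in the two base cotangents.

  Let \<open>G\<^sub>j(t\<^sub>j, t\<^sub>j\<^sub>+\<^sub>1) = c\<close> and \<open>G\<^sub>j(u\<^sub>j, u\<^sub>j\<^sub>+\<^sub>1) = d\<close> for all \<open>j\<close> with \<open>c \<le> d\<close>. If \<open>u\<^sub>j < t\<^sub>j\<close> for one \<open>j\<close>,
  monotonicity propagates this to the successor and hence around the cycle, so solutions with equal
  sums coincide. For existence, \<open>t\<^sub>0 = s\<close> and \<open>c\<close> determine \<open>t\<^sub>1, t\<^sub>2, \<dots>\<close>; exactly one \<open>c\<close> closes the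
  orbit, and the closed orbit increases with \<open>s\<close>. Each step takes a root of a monotone function, so
  everything depends continuously on the polygon; for the regular polygon the closed orbit is
  constantly \<open>s\<close>, so nearby polygons have an orbit with sum \<open>0\<close> for some small \<open>s\<close>.

  Since the weights close up, each apex has equal weighted distances from three consecutive side
  lines. So the weighted distances from two adjacent side lines agree along the side shared by the
  two triangles, which puts the cells inside the triangles.
\<close>

section \<open>Periodic sequences and roots of monotone functions\<close>

lemma periodic_mult: "periodic n f \<Longrightarrow> f (i + n * k) = f i"
proof (induction k)
  case (Suc k)
  have "f (i + n * Suc k) = f (i + n * k + n)"
    by (simp add: ac_simps)
  then show ?case
    using Suc by (simp add: periodic_def)
qed simp

lemma periodic_cong:
  assumes "periodic n f" "i mod n = j mod n"
  shows "f i = f j"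
  using periodic_mult[OF assms(1), of "i mod n" "i div n"]
    periodic_mult[OF assms(1), of "j mod n" "j div n"] assms(2) by (metis mod_mult_div_eq)

text \<open>\<open>i + n * j\<close> is congruent to \<open>i\<close> and not below
  \<open>j\<close>, so the property travels forward from \<open>j\<close> to it, and periodicity
  carries it to \<open>i\<close>.\<close>

lemma periodic_forward_closed:
  assumes "0 < n" "periodic n P" and step: "\<And>j. P j \<Longrightarrow> P (Suc j)" and "P j"
  shows "P i"
proof -
  have "P (j + k)" for k
    by (induction k) (use assms in auto)
  moreover have "j + (i + n * j - j) = i + n * j"
    using \<open>0 < n\<close> by (cases n) auto
  ultimately have "P (i + n * j)"
    by metis
  then show ?thesis
    using periodic_mult[OF assms(2)] by simp
qed

text \<open>For \<open>a < y\<^sub>0\<close> the limit function is negative at \<open>a\<close>. By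
  pointwise convergence so are the nearby ones, and monotonicity puts their roots to the right of
  \<open>a\<close>.\<close>

lemma tendsto_root:
  fixes \<Phi> :: "'p \<Rightarrow> real \<Rightarrow> real"
  assumes mono: "eventually (\<lambda>p. strict_mono (\<Phi> p)) F" "strict_mono \<Phi>\<^sub>0"
    and lim: "\<And>y. ((\<lambda>p. \<Phi> p y) \<longlongrightarrow> \<Phi>\<^sub>0 y) F"
    and root: "eventually (\<lambda>p. \<Phi> p (r p) = 0) F" "\<Phi>\<^sub>0 y\<^sub>0 = 0"
  shows "(r \<longlongrightarrow> y\<^sub>0) F"
proof (rule order_tendstoI)
  fix a assume "a < y\<^sub>0"
  then have "\<Phi>\<^sub>0 a < 0"
    using mono(2) root(2) by (metis strict_monoD)
  then have "eventually (\<lambda>p. \<Phi> p a < 0) F"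
    using lim order_tendstoD(2) by blast
  then show "eventually (\<lambda>p. a < r p) F"
    using mono(1) root(1) by eventually_elim (metis strict_mono_less)
next
  fix a assume "y\<^sub>0 < a"
  then have "0 < \<Phi>\<^sub>0 a"
    using mono(2) root(2) by (metis strict_monoD)
  then have "eventually (\<lambda>p. 0 < \<Phi> p a) F"
    using lim order_tendstoD(1) by blast
  then show "eventually (\<lambda>p. r p < a) F"
    using mono(1) root(1) by eventually_elim (metis strict_mono_less)
qed

section \<open>Monotone cyclic systems of equations\<close>

text \<open>\<open>rigid\<close> abstracts the comparison of two solutions:
  \<open>u j \<le> t j\<close> can be reversed in the next step only with equality at both indices.
  So \<open><\<close> and \<open>\<le>\<close> pass to the successor and around the cycle.\<close>

lemma cyclic_comparison:
  fixes t u :: "nat \<Rightarrow> real"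
  assumes "0 < n" "periodic n t" "periodic n u"
    and rigid: "\<And>j. u j \<le> t j \<Longrightarrow> t (Suc j) \<le> u (Suc j) \<Longrightarrow> t j = u j \<and> t (Suc j) = u (Suc j)"
  shows "u j < t j \<Longrightarrow> u i < t i" "u j \<le> t j \<Longrightarrow> u i \<le> t i"
proof -
  have per: "periodic n (\<lambda>i. u i < t i)" "periodic n (\<lambda>i. u i \<le> t i)"
    using assms by (auto simp: periodic_def)
  show "u j < t j \<Longrightarrow> u i < t i"
  proof (rule periodic_forward_closed[OF assms(1) per(1)])
    show "u (Suc k) < t (Suc k)" if "u k < t k" for k
      using rigid[of k] that by linarith
  qed
  show "u j \<le> t j \<Longrightarrow> u i \<le> t i"
  proof (rule periodic_forward_closed[OF assms(1) per(2)])
    show "u (Suc k) \<le> t (Suc k)" if "u k \<le> t k" for k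
      using rigid[of k] that by linarith
  qed
qed

text \<open>If \<open>u j < t j\<close> once, then it holds everywhere and the sums differ;
  otherwise \<open>t \<le> u\<close> everywhere and equal sums force equality.\<close>

lemma cyclic_unique:
  fixes t u :: "nat \<Rightarrow> real"
  assumes n: "0 < n" "periodic n t" "periodic n u"
    and rigid: "\<And>j. u j \<le> t j \<Longrightarrow> t (Suc j) \<le> u (Suc j) \<Longrightarrow> t j = u j \<and> t (Suc j) = u (Suc j)"
    and sum: "(\<Sum>j<n. t j) = (\<Sum>j<n. u j)"
  shows "t = u"
proof (cases "\<exists>j. u j < t j")
  case True
  then have "u i < t i" for i
    using cyclic_comparison(1)[OF n rigid] by blast
  then have "(\<Sum>j<n. u j) < (\<Sum>j<n. t j)"
    using n by (intro sum_strict_mono) auto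
  with sum show ?thesis by simp
next
  case False
  then have le: "t i \<le> u i" for i
    by (meson not_le)
  have lt: "t j = u j" if "j < n" for j
  proof (rule ccontr)
    assume "t j \<noteq> u j"
    then have "(\<Sum>j<n. t j) < (\<Sum>j<n. u j)"
      using le that by (intro sum_strict_mono_ex1) (auto simp: less_le)
    with sum show False by simp
  qed
  show ?thesis
  proof
    fix i
    show "t i = u i"
      using lt[of "i mod n"] n(1) periodic_cong[OF n(2), of i "i mod n"]
        periodic_cong[OF n(3), of i "i mod n"] by simp
  qed
qed

text \<open>\<open>G_unbounded\<close> makes \<open>G j x y = c\<close> solvable in \<open>y\<close>
  at every level. The geometric ratio is shown to be monotone only where the base cotangents have
  positive sum, so it enters through \<open>clamped\<close>.\<close>

locale cyclic_system =
  fixes n :: nat and G :: "nat \<Rightarrow> real \<Rightarrow> real \<Rightarrow> real"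
  assumes n_pos: "0 < n"
    and G_periodic: "periodic n G"
    and G_mono: "x \<le> x' \<Longrightarrow> y' \<le> y \<Longrightarrow> x < x' \<or> y' < y \<Longrightarrow> G j x y < G j x' y'"
    and G_cont1: "continuous_on UNIV (\<lambda>x. G j x y)"
    and G_cont2: "continuous_on UNIV (\<lambda>y. G j x y)"
    and G_unbounded: "\<exists>y. c \<le> G j x y" "\<exists>y. G j x y \<le> c"

definition cyclic_solution :: "nat \<Rightarrow> (nat \<Rightarrow> real \<Rightarrow> real \<Rightarrow> real) \<Rightarrow> real \<Rightarrow> (nat \<Rightarrow> real) \<Rightarrow> bool" where
  "cyclic_solution n G c t \<longleftrightarrow> periodic n t \<and> (\<forall>j. G j (t j) (t (Suc j)) = c)"

definition next_value :: "(nat \<Rightarrow> real \<Rightarrow> real \<Rightarrow> real) \<Rightarrow> nat \<Rightarrow> real \<Rightarrow> real \<Rightarrow> real" where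
  "next_value G j x c = (THE y. G j x y = c)"

primrec shoot :: "(nat \<Rightarrow> real \<Rightarrow> real \<Rightarrow> real) \<Rightarrow> real \<Rightarrow> real \<Rightarrow> nat \<Rightarrow> real" where
  "shoot G s c 0 = s"
| "shoot G s c (Suc j) = next_value G j (shoot G s c j) c"

definition closing_level :: "nat \<Rightarrow> (nat \<Rightarrow> real \<Rightarrow> real \<Rightarrow> real) \<Rightarrow> real \<Rightarrow> real" where
  "closing_level n G s = (THE c. shoot G s c n = s)"

definition closed_orbit :: "nat \<Rightarrow> (nat \<Rightarrow> real \<Rightarrow> real \<Rightarrow> real) \<Rightarrow> real \<Rightarrow> nat \<Rightarrow> real" where
  "closed_orbit n G s = shoot G s (closing_level n G s)"

text \<open>The first argument varies because it is the output of the preceding shooting step. The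
  second is the unknown, and \<open>tendsto_root\<close> works from pointwise convergence in
  it.\<close>

definition cyclic_limit ::
    "'p filter \<Rightarrow> ('p \<Rightarrow> nat \<Rightarrow> real \<Rightarrow> real \<Rightarrow> real) \<Rightarrow> (nat \<Rightarrow> real \<Rightarrow> real \<Rightarrow> real) \<Rightarrow> bool" where
  "cyclic_limit F G G\<^sub>0 \<longleftrightarrow>
     (\<forall>j y x x\<^sub>0. (x \<longlongrightarrow> x\<^sub>0) F \<longrightarrow> ((\<lambda>p. G p j (x p) y) \<longlongrightarrow> G\<^sub>0 j x\<^sub>0 y) F)"

context cyclic_system
begin

lemma G_inj2: "G j x y = G j x y' \<Longrightarrow> y = y'"
  using G_mono[of x x y y' j] G_mono[of x x y' y j] by (cases y y' rule: linorder_cases) auto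

lemma ex1_next: "\<exists>!y. G j x y = c"
proof (rule ex_ex1I)
  obtain a b where a: "c \<le> G j x a" and b: "G j x b \<le> c"
    using G_unbounded by meson
  have "a \<le> b"
    using G_mono[of x x b a j] a b by force
  then show "\<exists>y. G j x y = c"
    using IVT2'[of "G j x" b c a] a b continuous_on_subset[OF G_cont2] by blast
qed (use G_inj2 in metis)

lemma next_value: "G j x (next_value G j x c) = c"
  unfolding next_value_def by (rule theI'[OF ex1_next])

lemma next_value_mono:
  assumes "x \<le> x'" "c' \<le> c"
  shows "next_value G j x c \<le> next_value G j x' c'"
proof (rule ccontr)
  assume "\<not> ?thesis"
  then have "G j x (next_value G j x c) < G j x' (next_value G j x' c')"
    using assms by (intro G_mono) auto
  then show False
    using assms by (simp add: next_value)
qed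

lemma next_value_strict_antimono:
  assumes "x \<le> x'" "c' < c"
  shows "next_value G j x c < next_value G j x' c'"
proof (rule ccontr)
  assume "\<not> ?thesis"
  then have "G j x (next_value G j x c) \<le> G j x' (next_value G j x' c')"
    using assms G_mono[of x x' "next_value G j x' c'" "next_value G j x c" j]
    by (cases "x = x' \<and> next_value G j x' c' = next_value G j x c") (auto simp: less_le)
  then show False
    using assms by (simp add: next_value)
qed

lemma shoot_antimono: "c' \<le> c \<Longrightarrow> shoot G s c j \<le> shoot G s c' j"
  by (induction j) (auto intro: next_value_mono)

lemma shoot_strict_antimono: "c' < c \<Longrightarrow> shoot G s c (Suc j) < shoot G s c' (Suc j)"
  by (simp add: next_value_strict_antimono shoot_antimono)

text \<open>The constant sequence \<open>s\<close> is a barrier: a step from at most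
  \<open>s\<close> to above \<open>s\<close> would push \<open>G k\<close> strictly below
  \<open>G k s s \<le> c\<close>.\<close>

lemma shoot_le:
  assumes "\<And>j. j < k \<Longrightarrow> G j s s \<le> c"
  shows "shoot G s c k \<le> s"
  using assms
proof (induction k)
  case (Suc k)
  show ?case
  proof (rule ccontr)
    assume "\<not> ?case"
    then have "G k (shoot G s c k) (shoot G s c (Suc k)) < G k s s"
      using Suc by (intro G_mono) auto
    then show False
      using Suc.prems[of k] by (simp add: next_value)
  qed
qed auto

lemma shoot_ge:
  assumes "\<And>j. j < k \<Longrightarrow> c \<le> G j s s"
  shows "s \<le> shoot G s c k"
  using assms
proof (induction k)
  case (Suc k)
  show ?case
  proof (rule ccontr)
    assume "\<not> ?case"
    then have "G k s s < G k (shoot G s c k) (shoot G s c (Suc k))"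
      using Suc by (intro G_mono) auto
    then show False
      using Suc.prems[of k] by (simp add: next_value)
  qed
qed auto

end

text \<open>The next value is the root of \<open>c - G j x y\<close>, which increases in
  \<open>y\<close>, so \<open>tendsto_root\<close> applies.\<close>

lemma next_value_tendsto:
  assumes "eventually (\<lambda>p. cyclic_system n (G p)) F" "cyclic_system n G\<^sub>0"
    and "cyclic_limit F G G\<^sub>0" "(x \<longlongrightarrow> x\<^sub>0) F" "(c \<longlongrightarrow> c\<^sub>0) F"
  shows "((\<lambda>p. next_value (G p) j (x p) (c p)) \<longlongrightarrow> next_value G\<^sub>0 j x\<^sub>0 c\<^sub>0) F"
proof (rule tendsto_root[where \<Phi> = "\<lambda>p y. c p - G p j (x p) y" and \<Phi>\<^sub>0 = "\<lambda>y. c\<^sub>0 - G\<^sub>0 j x\<^sub>0 y"])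
  have mono: "strict_mono (\<lambda>y. c - H j x y)" if "cyclic_system n H" for c x H
    using cyclic_system.G_mono[OF that] by (auto simp: strict_mono_def)
  show "eventually (\<lambda>p. strict_mono (\<lambda>y. c p - G p j (x p) y)) F"
    using assms(1) by eventually_elim (rule mono)
  show "strict_mono (\<lambda>y. c\<^sub>0 - G\<^sub>0 j x\<^sub>0 y)"
    using assms(2) by (rule mono)
  show "((\<lambda>p. c p - G p j (x p) y) \<longlongrightarrow> c\<^sub>0 - G\<^sub>0 j x\<^sub>0 y) F" for y
    using assms(3-5) unfolding cyclic_limit_def by (intro tendsto_diff) auto
  show "eventually (\<lambda>p. c p - G p j (x p) (next_value (G p) j (x p) (c p)) = 0) F"
    using assms(1) by eventually_elim (simp add: cyclic_system.next_value)
  show "c\<^sub>0 - G\<^sub>0 j x\<^sub>0 (next_value G\<^sub>0 j x\<^sub>0 c\<^sub>0) = 0"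
    using assms(2) by (simp add: cyclic_system.next_value)
qed

lemma shoot_tendsto:
  assumes "eventually (\<lambda>p. cyclic_system n (G p)) F" "cyclic_system n G\<^sub>0"
    and "cyclic_limit F G G\<^sub>0" "(s \<longlongrightarrow> s\<^sub>0) F" "(c \<longlongrightarrow> c\<^sub>0) F"
  shows "((\<lambda>p. shoot (G p) (s p) (c p) j) \<longlongrightarrow> shoot G\<^sub>0 s\<^sub>0 c\<^sub>0 j) F"
  by (induction j) (use assms next_value_tendsto in auto)

text \<open>The constant family turns the convergence lemmas into continuity for one fixed system,
  as the intermediate value arguments require.\<close>

lemma (in cyclic_system) cyclic_limit_const: "cyclic_limit F (\<lambda>_. G) G"
  unfolding cyclic_limit_def
proof (intro allI impI)
  fix j and y x\<^sub>0 :: real and x :: "'a \<Rightarrow> real"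
  assume "(x \<longlongrightarrow> x\<^sub>0) F"
  moreover have "isCont (\<lambda>x. G j x y) x\<^sub>0"
    using G_cont1 continuous_on_eq_continuous_at by blast
  ultimately show "((\<lambda>p. G j (x p) y) \<longlongrightarrow> G j x\<^sub>0 y) F"
    using isCont_tendsto_compose by blast
qed

context cyclic_system
begin

text \<open>The endpoint of the orbit is continuous and strictly decreasing in the level.\<close>

lemma ex1_closing_level: "\<exists>!c. shoot G s c n = s"
proof (rule ex_ex1I)
  have fin: "finite ((\<lambda>j. G j s s) ` {..<n})" "(\<lambda>j. G j s s) ` {..<n} \<noteq> {}"
    using n_pos by auto
  \<comment> \<open>At the smallest and at the largest diagonal value a barrier holds throughout, so
    the two endpoints enclose \<open>s\<close>.\<close>
  define a where "a = Min ((\<lambda>j. G j s s) ` {..<n})"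
  define b where "b = Max ((\<lambda>j. G j s s) ` {..<n})"
  have ab: "a \<le> b"
    unfolding a_def b_def using fin by (meson Max_ge Min_in)
  have cont: "continuous_on {a..b} (\<lambda>c. shoot G s c n)"
    unfolding continuous_on_def
    by (intro ballI shoot_tendsto[where n = n] cyclic_limit_const) (auto intro: cyclic_system_axioms always_eventually)
  have "shoot G s b n \<le> s" "s \<le> shoot G s a n"
    unfolding a_def b_def by (rule shoot_le shoot_ge; simp add: Min_le Max_ge)+
  then show "\<exists>c. shoot G s c n = s"
    using IVT2'[of "\<lambda>c. shoot G s c n" b s a] ab cont by blast
next
  fix c c' assume "shoot G s c n = s" "shoot G s c' n = s"
  moreover obtain m where "n = Suc m"
    using n_pos gr0_conv_Suc by blast
  ultimately show "c = c'"
    using shoot_strict_antimono[of c c' s m] shoot_strict_antimono[of c' c s m]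
    by (cases c c' rule: linorder_cases) (auto simp del: shoot.simps)
qed

lemma closing_level: "shoot G s (closing_level n G s) n = s"
  unfolding closing_level_def by (rule theI'[OF ex1_closing_level])

lemma closed_orbit_solution:
  "cyclic_solution n G (closing_level n G s) (closed_orbit n G s)" "closed_orbit n G s 0 = s"
proof -
  have G_per: "G (j + n) = G j" for j
    using G_periodic by (simp add: periodic_def)
  have "closed_orbit n G s (j + n) = closed_orbit n G s j" for j
    by (induction j) (auto simp: closed_orbit_def closing_level next_value_def G_per)
  moreover have "G j (closed_orbit n G s j) (closed_orbit n G s (Suc j)) = closing_level n G s" for j
    by (simp add: closed_orbit_def next_value)
  ultimately show "cyclic_solution n G (closing_level n G s) (closed_orbit n G s)"
    by (simp add: cyclic_solution_def periodic_def)
qed (simp add: closed_orbit_def)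

text \<open>A strict inequality in either comparison would give \<open>d < c\<close> by
  \<open>G_mono\<close>. This supplies \<open>rigid\<close> for the cyclic comparison.\<close>

lemma solutions_rigid:
  assumes "cyclic_solution n G c t" "cyclic_solution n G d u" "c \<le> d" "u j \<le> t j" "t (Suc j) \<le> u (Suc j)"
  shows "t j = u j \<and> t (Suc j) = u (Suc j)"
  using assms G_mono[of "u j" "t j" "t (Suc j)" "u (Suc j)" j]
  unfolding cyclic_solution_def by force

lemma solution_unique:
  assumes "cyclic_solution n G c t" "cyclic_solution n G d u" "(\<Sum>j<n. t j) = (\<Sum>j<n. u j)"
  shows "t = u"
proof -
  have per: "periodic n t" "periodic n u"
    using assms by (auto simp: cyclic_solution_def)
  show ?thesis
  proof (cases "c \<le> d")
    case True
    with assms show ?thesis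
      by (intro cyclic_unique[OF n_pos per]) (auto dest: solutions_rigid)
  next
    case False
    then have "u = t"
      using assms by (intro cyclic_unique[OF n_pos per(2,1)]) (auto dest: solutions_rigid)
    then show ?thesis ..
  qed
qed

text \<open>Depending on which level is larger, either \<open><\<close> travels forward from index
  \<open>0\<close>, or a failure at \<open>j\<close> travels forward to index
  \<open>0\<close>.\<close>

lemma closed_orbit_strict_mono:
  assumes "s < s'"
  shows "closed_orbit n G s j < closed_orbit n G s' j"
proof -
  let ?t = "closed_orbit n G s" and ?u = "closed_orbit n G s'"
  let ?c = "closing_level n G s" and ?d = "closing_level n G s'"
  note sol = closed_orbit_solution(1)[of s] closed_orbit_solution(1)[of s']
  have per: "periodic n ?t" "periodic n ?u"
    using sol by (auto simp: cyclic_solution_def)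
  have 0: "?t 0 < ?u 0"
    using assms by (simp add: closed_orbit_solution)
  show ?thesis
  proof (cases "?d \<le> ?c")
    case True
    show ?thesis
      by (rule cyclic_comparison(1)[OF n_pos per(2,1) _ 0])
        (use solutions_rigid[OF sol(2,1) True] in blast)
  next
    case False
    then have "?c \<le> ?d" by simp
    have "?u 0 \<le> ?t 0" if "?u j \<le> ?t j"
      by (rule cyclic_comparison(2)[OF n_pos per _ that])
        (use solutions_rigid[OF sol \<open>?c \<le> ?d\<close>] in blast)
    with 0 show ?thesis by force
  qed
qed

end

text \<open>The closing level is itself the root of a strictly increasing function of
  \<open>c\<close>, so it converges by \<open>tendsto_root\<close>; the orbit follows by
  \<open>shoot_tendsto\<close>.\<close>

lemma closed_orbit_tendsto:
  assumes "eventually (\<lambda>p. cyclic_system n (G p)) F" "cyclic_system n G\<^sub>0"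
    and "cyclic_limit F G G\<^sub>0" "(s \<longlongrightarrow> s\<^sub>0) F"
  shows "((\<lambda>p. closed_orbit n (G p) (s p) j) \<longlongrightarrow> closed_orbit n G\<^sub>0 s\<^sub>0 j) F"
  unfolding closed_orbit_def
proof (rule shoot_tendsto[OF assms], rule tendsto_root[where \<Phi> = "\<lambda>p c. s p - shoot (G p) (s p) c n"
      and \<Phi>\<^sub>0 = "\<lambda>c. s\<^sub>0 - shoot G\<^sub>0 s\<^sub>0 c n"])
  have mono: "strict_mono (\<lambda>c. s - shoot H s c n)" if H: "cyclic_system n H" for s H
  proof -
    obtain m where "n = Suc m"
      using cyclic_system.n_pos[OF H] gr0_conv_Suc by blast
    then show ?thesis
      using cyclic_system.shoot_strict_antimono[OF H, of _ _ s m]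
      by (auto simp: strict_mono_def simp del: shoot.simps)
  qed
  show "eventually (\<lambda>p. strict_mono (\<lambda>c. s p - shoot (G p) (s p) c n)) F"
    using assms(1) by eventually_elim (rule mono)
  show "strict_mono (\<lambda>c. s\<^sub>0 - shoot G\<^sub>0 s\<^sub>0 c n)"
    using assms(2) by (rule mono)
  show "((\<lambda>p. s p - shoot (G p) (s p) c n) \<longlongrightarrow> s\<^sub>0 - shoot G\<^sub>0 s\<^sub>0 c n) F" for c
    by (intro tendsto_diff shoot_tendsto[OF assms(1-3)] assms tendsto_const)
  show "eventually (\<lambda>p. s p - shoot (G p) (s p) (closing_level n (G p) (s p)) n = 0) F"
    using assms(1) by eventually_elim (simp add: cyclic_system.closing_level)
  show "s\<^sub>0 - shoot G\<^sub>0 s\<^sub>0 (closing_level n G\<^sub>0 s\<^sub>0) n = 0"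
    using assms(2) by (simp add: cyclic_system.closing_level)
qed

text \<open>At level \<open>G 0 s s\<close> both barriers apply and keep the orbit at
  \<open>s\<close>. So it closes up, and the closing level is unique.\<close>

lemma closed_orbit_symmetric:
  assumes "cyclic_system n G" and sym: "\<And>j. G j s s = G 0 s s"
  shows "closed_orbit n G s j = s"
proof -
  interpret cyclic_system n G by fact
  have "shoot G s (G 0 s s) k = s" for k
    by (rule antisym; rule shoot_le shoot_ge; metis sym order_refl)
  then have "closing_level n G s = G 0 s s"
    using closing_level ex1_closing_level by blast
  then show ?thesis
    using \<open>\<And>k. shoot G s (G 0 s s) k = s\<close> by (simp add: closed_orbit_def)
qed

text \<open>In the limit the closed orbits through \<open>s\<close> and \<open>- s\<close> are
  constant, so nearby the first is positive and the second negative, both within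
  \<open>\<epsilon>\<close>. The sum over the orbit is continuous in the starting value and vanishes
  for some orbit in between.\<close>

lemma ex_small_solution:
  assumes ev: "eventually (\<lambda>p. cyclic_system n (G p)) F" and G\<^sub>0: "cyclic_system n G\<^sub>0"
    and lim: "cyclic_limit F G G\<^sub>0" and sym: "\<And>j s. G\<^sub>0 j s s = G\<^sub>0 0 s s" and "0 < \<epsilon>"
  shows "eventually (\<lambda>p. \<exists>t c. cyclic_solution n (G p) c t \<and> (\<Sum>j<n. t j) = 0 \<and>
           (\<forall>j<n. \<bar>t j\<bar> < \<epsilon>)) F"
proof -
  define s where "s = \<epsilon> / 2"
  have s: "0 < s" "s < \<epsilon>"
    using \<open>0 < \<epsilon>\<close> by (auto simp: s_def)
  let ?x = "\<lambda>p s. closed_orbit n (G p) s"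
  have conv: "((\<lambda>p. ?x p r j) \<longlongrightarrow> r) F" for r j
    using closed_orbit_tendsto[OF ev G\<^sub>0 lim tendsto_const, of r j] closed_orbit_symmetric[OF G\<^sub>0 sym] by simp
  have lo: "eventually (\<lambda>p. \<forall>j\<in>{..<n}. - \<epsilon> < ?x p (- s) j \<and> ?x p (- s) j < 0) F"
    using order_tendstoD[OF conv[of "- s"]] s
    by (intro eventually_ball_finite eventually_conj ballI) auto
  have hi: "eventually (\<lambda>p. \<forall>j\<in>{..<n}. 0 < ?x p s j \<and> ?x p s j < \<epsilon>) F"
    using order_tendstoD[OF conv[of s]] s
    by (intro eventually_ball_finite eventually_conj ballI) auto
  show ?thesis
    using ev lo hi
  proof eventually_elim
    case (elim p)
    interpret cyclic_system n "G p" by fact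
    have "continuous_on {- s..s} (\<lambda>r. \<Sum>j<n. ?x p r j)"
      unfolding continuous_on_def
      by (intro ballI tendsto_sum closed_orbit_tendsto cyclic_limit_const)
        (auto intro: cyclic_system_axioms always_eventually)
    moreover have "(\<Sum>j<n. ?x p (- s) j) \<le> 0" "0 \<le> (\<Sum>j<n. ?x p s j)"
      using elim by (auto intro!: sum_nonpos sum_nonneg simp: less_imp_le)
    ultimately obtain r where r: "- s \<le> r" "r \<le> s" and sum: "(\<Sum>j<n. ?x p r j) = 0"
      using IVT'[of "\<lambda>r. \<Sum>j<n. ?x p r j" "- s" 0 s] s by auto
    have "\<bar>?x p r j\<bar> < \<epsilon>" if "j < n" for j
    proof -
      have "?x p (- s) j \<le> ?x p r j" "?x p r j \<le> ?x p s j"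
        using r closed_orbit_strict_mono by (cases "- s = r"; cases "r = s"; force simp: less_le)+
      then show ?thesis
        using elim that by (force simp: abs_less_iff)
    qed
    then show ?case
      using closed_orbit_solution(1) sum by blast
  qed
qed

text \<open>The solutions from \<open>ex_small_solution\<close> depend on \<open>\<epsilon>\<close>.
  One solution per parameter is chosen beforehand, and uniqueness identifies it with the small one
  for every \<open>\<epsilon>\<close>.\<close>

lemma solution_tendsto_0:
  assumes ev: "eventually (\<lambda>p. cyclic_system n (G p)) F" and G\<^sub>0: "cyclic_system n G\<^sub>0"
    and lim: "cyclic_limit F G G\<^sub>0" and sym: "\<And>j s. G\<^sub>0 j s s = G\<^sub>0 0 s s"
  obtains t c where
    "eventually (\<lambda>p. cyclic_solution n (G p) (c p) (t p) \<and> (\<Sum>j<n. t p j) = 0) F"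
    "\<And>j. ((\<lambda>p. t p j) \<longlongrightarrow> 0) F"
proof -
  define Q where "Q p c t \<longleftrightarrow> cyclic_solution n (G p) c t \<and> (\<Sum>j<n. t j) = 0" for p c t
  define t where "t p = (SOME t. \<exists>c. Q p c t)" for p
  define c where "c p = (SOME c. Q p c (t p))" for p
  have Q: "Q p (c p) (t p)" if "Q p d u" for p d u
  proof -
    have "\<exists>c. Q p c (t p)"
      using someI_ex[of "\<lambda>t. \<exists>c. Q p c t"] that unfolding t_def by blast
    then show ?thesis
      unfolding c_def by (rule someI_ex)
  qed
  note small = ex_small_solution[OF ev G\<^sub>0 lim sym]
  have 1: "eventually (\<lambda>p. Q p (c p) (t p)) F"
    using small[OF zero_less_one]
  proof eventually_elim
    case (elim p)
    then obtain u d where "Q p d u"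
      by (auto simp: Q_def)
    then show ?case
      by (rule Q)
  qed
  have "((\<lambda>p. t p j) \<longlongrightarrow> 0) F" for j
  proof (rule tendstoI)
    fix \<epsilon> :: real assume "0 < \<epsilon>"
    show "eventually (\<lambda>p. dist (t p j) 0 < \<epsilon>) F"
      using ev 1 small[OF \<open>0 < \<epsilon>\<close>]
    proof eventually_elim
      case (elim p)
      then obtain d u where u: "Q p d u" "\<forall>j<n. \<bar>u j\<bar> < \<epsilon>"
        by (auto simp: Q_def)
      have "t p = u"
        using cyclic_system.solution_unique[OF elim(1)] u(1) elim(2) by (auto simp: Q_def)
      moreover have "u j = u (j mod n)"
        using periodic_cong[of n u j "j mod n"] u(1) by (simp add: Q_def cyclic_solution_def)
      ultimately show ?case
        using u(2) cyclic_system.n_pos[OF elim(1)] by (simp add: dist_real_def)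
    qed
  qed
  with 1 that show thesis
    unfolding Q_def by blast
qed

section \<open>Plane geometry\<close>

text \<open>Carries the area formula \<open>content_triangle\<close>, stated for
  \<open>real ^ 2\<close>, over to \<open>complex\<close>. Agreement on boxes determines the
  measure.\<close>

lemma lborel_complex_eq_distr:
  "lborel = distr (lborel :: (real ^ 2) measure) borel (\<lambda>v. Complex (v $ 1) (v $ 2))"
proof (rule lborel_eqI)
  let ?f = "\<lambda>v :: real ^ 2. Complex (v $ 1) (v $ 2)"
  have f: "?f \<in> borel_measurable lborel"
    by (simp add: borel_measurable_continuous_onI continuous_intros Complex_eq)
  fix l u :: complex
  assume le: "\<And>b. b \<in> Basis \<Longrightarrow> l \<bullet> b \<le> u \<bullet> b"
  let ?v = "\<lambda>z. vector [Re z, Im z] :: real ^ 2"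
  have basis: "(Basis :: (real ^ 2) set) = {axis 1 1, axis 2 1}"
    by (auto simp: Basis_vec_def UNIV_2)
  have ne: "axis 1 1 \<noteq> (axis 2 1 :: real ^ 2)"
    by (simp add: axis_eq_axis)
  have eq: "?f -` box l u = box (?v l) (?v u)"
    by (auto simp: box_def basis Basis_complex_def inner_axis)
  have "Re l \<le> Re u" "Im l \<le> Im u"
    using le[of 1] le[of \<i>] by (auto simp: Basis_complex_def)
  moreover from this have "emeasure lborel (box (?v l) (?v u)) = (Re u - Re l) * (Im u - Im l)"
    by (subst emeasure_lborel_box) (auto simp: basis ne inner_axis inner_diff_left)
  ultimately show "emeasure (distr lborel borel ?f) (box l u) = (\<Prod>b\<in>Basis. (u - l) \<bullet> b)"
    by (subst emeasure_distr[OF f]) (auto simp: eq Basis_complex_def)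
qed simp

lemma measure_triangle_complex:
  fixes P Q R :: complex
  shows "measure lebesgue (convex hull {P, Q, R}) = \<bar>Im (cnj (Q - P) * (R - P))\<bar> / 2"
proof -
  let ?f = "\<lambda>v :: real ^ 2. Complex (v $ 1) (v $ 2)"
  let ?v = "\<lambda>z. vector [Re z, Im z] :: real ^ 2"
  have f: "?f \<in> borel_measurable lborel"
    by (simp add: borel_measurable_continuous_onI continuous_intros Complex_eq)
  have lin: "linear ?f"
    by (rule linearI) (auto simp: complex_eq_iff)
  have inj: "inj ?f"
    by (auto simp: inj_def vec_eq_iff forall_2)
  have "convex hull {P, Q, R} = ?f ` (convex hull {?v P, ?v Q, ?v R})"
    by (simp add: convex_hull_linear_image[OF lin])
  then have vim: "?f -` (convex hull {P, Q, R}) = convex hull {?v P, ?v Q, ?v R}"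
    using inj by (simp add: inj_vimage_image_eq)
  have borel: "convex hull {P, Q, R} \<in> sets borel"
    by (simp add: borel_compact compact_convex_hull)
  have "measure lebesgue (convex hull {P, Q, R}) = measure lborel (convex hull {P, Q, R})"
    using borel by simp
  also have "\<dots> = measure lborel (convex hull {?v P, ?v Q, ?v R})"
    using borel by (subst lborel_complex_eq_distr) (simp add: measure_distr[OF f] vim)
  also have "\<dots> = \<bar>Im (cnj (Q - P) * (R - P))\<bar> / 2"
    unfolding content_triangle by (simp add: algebra_simps abs_minus_commute)
  finally show ?thesis .
qed

lemma infdist_line:
  fixes P Q z :: complex
  assumes "P \<noteq> Q"
  shows "infdist z (affine hull {P, Q}) = \<bar>Im (cnj (sgn (Q - P)) * (z - P))\<bar>"
proof -
  let ?e = "sgn (Q - P)"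
  have e1: "norm ?e = 1"
    using assms by (simp add: norm_sgn)
  then have e2: "cnj ?e * ?e = 1"
    using complex_norm_square[of ?e] by (simp add: mult.commute)
  have e3: "Q - P = of_real (norm (Q - P)) * ?e"
    using assms by (simp add: sgn_eq)
  note e = e1 e2 e3
  show ?thesis
  proof (rule antisym)
    \<comment> \<open>\<open>r\<close> is the coordinate of \<open>z\<close> along the line, so
      \<open>?x\<close> is the foot of the perpendicular; multiplying by \<open>cnj ?e\<close> makes
      the line horizontal.\<close>
    define r where "r = Re (cnj ?e * (z - P))"
    define \<sigma> where "\<sigma> = r / norm (Q - P)"
    let ?x = "P + \<sigma> *\<^sub>R (Q - P)"
    have "\<sigma> *\<^sub>R (Q - P) = of_real (\<sigma> * norm (Q - P)) * ?e"
      by (subst (1) e3) (simp add: scaleR_conv_of_real)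
    then have x: "?x = P + of_real r * ?e"
      using assms by (simp add: \<sigma>_def)
    have "?x = (1 - \<sigma>) *\<^sub>R P + \<sigma> *\<^sub>R Q"
      by (simp add: algebra_simps)
    then have "?x \<in> affine hull {P, Q}"
      unfolding affine_hull_2 using diff_add_cancel by blast
    then have "infdist z (affine hull {P, Q}) \<le> dist z ?x"
      by (rule infdist_le)
    also have "\<dots> = norm (cnj ?e * (z - ?x))"
      using e(1) by (simp add: norm_mult dist_norm)
    also have "cnj ?e * (z - ?x) = cnj ?e * (z - P) - of_real r * (cnj ?e * ?e)"
      unfolding x by (simp add: algebra_simps)
    also have "\<dots> = \<i> * Im (cnj ?e * (z - P))"
      unfolding e(2) r_def by (simp add: complex_eq_iff)
    finally show "infdist z (affine hull {P, Q}) \<le> \<bar>Im (cnj ?e * (z - P))\<bar>"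
      by (simp only: norm_mult norm_ii norm_of_real mult_1)
  next
    have "\<bar>Im (cnj ?e * (z - P))\<bar> \<le> dist z y" if y: "y \<in> affine hull {P, Q}" for y
    proof -
      obtain u v where uv: "y = u *\<^sub>R P + v *\<^sub>R Q" "u + v = 1"
        using y unfolding affine_hull_2 by blast
      then have "y = P + v *\<^sub>R (Q - P)"
        by (simp add: algebra_simps flip: scaleR_add_left)
      then have "cnj ?e * (y - P) = of_real (v * norm (Q - P)) * (cnj ?e * ?e)"
        using e(3) by (simp add: scaleR_conv_of_real)
      then have "Im (cnj ?e * (y - P)) = 0"
        unfolding e(2) by simp
      then have "\<bar>Im (cnj ?e * (z - P))\<bar> = \<bar>Im (cnj ?e * (z - y))\<bar>"
        by (simp add: algebra_simps)
      also have "\<dots> \<le> norm (cnj ?e * (z - y))"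
        by (rule abs_Im_le_cmod)
      finally show ?thesis
        using e(1) by (simp add: norm_mult dist_norm)
    qed
    then show "\<bar>Im (cnj ?e * (z - P))\<bar> \<le> infdist z (affine hull {P, Q})"
      unfolding infdist_def by (auto intro!: cINF_greatest)
  qed
qed

text \<open>With the base along \<open>e\<close>, \<open>y\<close> is the height and
  \<open>B\<close>, \<open>C\<close> are the cotangents of the base angles. The altitude splits the
  apex angle into \<open>arctan B\<close> and \<open>arctan C\<close>.\<close>

lemma vertex_angle_frame:
  fixes P e :: complex
  assumes e: "norm e = 1" and y: "0 < y" and BC: "0 < B + C"
    and V: "V = P + e * Complex (B * y) y" and Q: "Q = P + e * of_real ((B + C) * y)"
  shows "vertex_angle P V Q = arctan B + arctan C"
proof -
  have ang: "0 \<le> arctan B + arctan C" "arctan B + arctan C \<le> pi"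
    using BC arctan_monotone'[of "- B" C] arctan_ubound[of B] arctan_ubound[of C]
    by (auto simp: arctan_minus)
  have "P - V = - (e * Complex (B * y) y)"
    unfolding V by simp
  moreover have "Q - V = e * Complex (C * y) (- y)"
    unfolding V Q by (simp add: complex_eq_iff algebra_simps)
  ultimately have norms: "norm (P - V) = y * sqrt (1 + B\<^sup>2)" "norm (Q - V) = y * sqrt (1 + C\<^sup>2)"
    and inner: "inner (P - V) (Q - V) = y\<^sup>2 * (1 - B * C)"
  proof -
    have *: "norm (Complex (D * y) y) = y * sqrt (1 + D\<^sup>2)" "norm (Complex (D * y) (-y)) = y * sqrt (1 + D\<^sup>2)" for D
    proof -
      have "(D * y)\<^sup>2 + y\<^sup>2 = y\<^sup>2 * (1 + D\<^sup>2)"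
        by (simp add: algebra_simps power_mult_distrib)
      then show "norm (Complex (D * y) y) = y * sqrt (1 + D\<^sup>2)" "norm (Complex (D * y) (-y)) = y * sqrt (1 + D\<^sup>2)"
        using y by (simp_all add: complex_norm real_sqrt_mult)
    qed
    assume PV: "P - V = - (e * Complex (B * y) y)" and QV: "Q - V = e * Complex (C * y) (- y)"
    show "norm (P - V) = y * sqrt (1 + B\<^sup>2)" "norm (Q - V) = y * sqrt (1 + C\<^sup>2)"
      unfolding PV QV using e by (simp_all add: norm_mult *)
    have "inner z w = Re (cnj z * w)" for z w :: complex
      by (simp add: inner_complex_def)
    then have "inner (P - V) (Q - V) = Re (cnj (P - V) * (Q - V))" .
    also have "cnj (P - V) * (Q - V) = - (cnj e * e * (cnj (Complex (B * y) y) * Complex (C * y) (- y)))"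
      unfolding PV QV by (simp add: algebra_simps)
    also have "cnj e * e = 1"
      using e by (simp add: mult.commute complex_norm_square[symmetric])
    finally show "inner (P - V) (Q - V) = y\<^sup>2 * (1 - B * C)"
      by (simp add: algebra_simps power2_eq_square)
  qed
  have "inner (P - V) (Q - V) / (norm (P - V) * norm (Q - V)) = cos (arctan B + arctan C)"
  proof -
    define b c where "b = sqrt (1 + B\<^sup>2)" and "c = sqrt (1 + C\<^sup>2)"
    have "0 < b" "0 < c"
      by (auto simp: b_def c_def add_pos_nonneg)
    then show ?thesis
      unfolding norms inner cos_add cos_arctan sin_arctan b_def[symmetric] c_def[symmetric]
      using y by (simp add: field_simps power2_eq_square)
  qed
  then show ?thesis
    unfolding vertex_angle_def using ang by (simp add: arccos_cos)
qed

text \<open>Cramer's rule in the basis \<open>Q - P\<close>, \<open>V - P\<close>, whose determinant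
  is nonzero.\<close>

lemma barycentric:
  fixes P Q V x :: complex
  assumes "Im (cnj (Q - P) * (V - P)) \<noteq> 0"
  obtains u v w where "u + v + w = 1" "x = u *\<^sub>R P + v *\<^sub>R Q + w *\<^sub>R V"
proof -
  define d where "d = Im (cnj (Q - P) * (V - P))"
  define w where "w = Im (cnj (Q - P) * (x - P)) / d"
  define v where "v = Im (cnj (x - P) * (V - P)) / d"
  have d: "d \<noteq> 0"
    using assms by (simp add: d_def)
  have dv: "d * v = Im (cnj (x - P) * (V - P))" and dw: "d * w = Im (cnj (Q - P) * (x - P))"
    using d by (auto simp: v_def w_def)
  have "d *\<^sub>R (x - P) = (d * v) *\<^sub>R (Q - P) + (d * w) *\<^sub>R (V - P)"
    unfolding dv dw by (simp add: d_def complex_eq_iff algebra_simps)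
  then have "d *\<^sub>R (x - P) = d *\<^sub>R (v *\<^sub>R (Q - P) + w *\<^sub>R (V - P))"
    by (simp add: algebra_simps)
  then have "x - P = v *\<^sub>R (Q - P) + w *\<^sub>R (V - P)"
    using d by (simp only: scaleR_cancel_left) simp
  then have "x = (1 - v - w) *\<^sub>R P + v *\<^sub>R Q + w *\<^sub>R V"
    by (simp add: algebra_simps)
  then show thesis
    by (rule that[rotated]) simp
qed

section \<open>Signed distances from the side lines\<close>

definition edge_dir :: "(nat \<Rightarrow> complex) \<Rightarrow> nat \<Rightarrow> complex" where
  "edge_dir A j = sgn (A (Suc j) - A j)"

definition signed_dist :: "(nat \<Rightarrow> complex) \<Rightarrow> nat \<Rightarrow> complex \<Rightarrow> real" where
  "signed_dist A j x = Im (cnj (edge_dir A j) * (x - A j))"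

text \<open>For unit edge directions this is \<open>cis\<close> of the exterior angle at
  \<open>A (Suc j)\<close>.\<close>

definition turn :: "(nat \<Rightarrow> complex) \<Rightarrow> nat \<Rightarrow> complex" where
  "turn A j = cnj (edge_dir A j) * edge_dir A (Suc j)"

text \<open>Signed instead of absolute distances make every condition affine; ranging over all
  \<open>j\<close> suits periodic weights.\<close>

definition weighted_cell :: "nat \<Rightarrow> (nat \<Rightarrow> complex) \<Rightarrow> (nat \<Rightarrow> real) \<Rightarrow> nat \<Rightarrow> complex set" where
  "weighted_cell n A q i =
     {x \<in> polygon_of n A. \<forall>j. q i * signed_dist A i x \<le> q j * signed_dist A j x}"

lemma collinear_iff_cross:
  fixes P Q R :: complex
  shows "collinear {P, Q, R} \<longleftrightarrow> Im (cnj (Q - P) * (R - P)) = 0"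
proof -
  have "collinear {P, Q, R} \<longleftrightarrow> collinear {0, Q - P, R - P}"
    using collinear_3[of Q P R] by (simp add: insert_commute)
  also have "\<dots> \<longleftrightarrow> Im (cnj (Q - P) * (R - P)) = 0"
  proof
    have "Im (cnj z * w) = 0" if "z = 0 \<or> w = 0 \<or> (\<exists>c. w = c *\<^sub>R z)" for z w
      using that by auto
    then show "collinear {0, Q - P, R - P} \<Longrightarrow> Im (cnj (Q - P) * (R - P)) = 0"
      unfolding collinear_lemma by blast
  next
    assume 0: "Im (cnj (Q - P) * (R - P)) = 0"
    show "collinear {0, Q - P, R - P}"
    proof (cases "Q = P")
      case False
      define r where "r = Re (cnj (Q - P) * (R - P))"
      have "cnj (Q - P) * (R - P) = of_real r"
        using 0 by (simp add: complex_eq_iff r_def)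
      then have "(Q - P) * cnj (Q - P) * (R - P) = of_real r * (Q - P)"
        by (simp add: mult_ac)
      then have "R - P = (r / (norm (Q - P))\<^sup>2) *\<^sub>R (Q - P)"
        using False unfolding complex_norm_square[symmetric]
        by (simp add: scaleR_conv_of_real field_simps)
      then show ?thesis
        unfolding collinear_lemma by blast
    qed simp
  qed
  finally show ?thesis .
qed

lemma signed_dist_affine:
  "u + v = 1 \<Longrightarrow> signed_dist A j (u *\<^sub>R x + v *\<^sub>R y) = u * signed_dist A j x + v * signed_dist A j y"
proof -
  assume "u + v = 1"
  then have v: "v = 1 - u"
    by simp
  show ?thesis
    unfolding v by (simp add: signed_dist_def algebra_simps)
qed

lemma signed_dist_affine3:
  assumes "u + v + w = 1"
  shows "signed_dist A j (u *\<^sub>R x + v *\<^sub>R y + w *\<^sub>R z) =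
    u * signed_dist A j x + v * signed_dist A j y + w * signed_dist A j z"
proof -
  have w: "w = 1 - u - v"
    using assms by simp
  show ?thesis
    unfolding w by (simp add: signed_dist_def algebra_simps)
qed

lemma signed_dist_midpoint:
  "signed_dist A j (midpoint x y) = (signed_dist A j x + signed_dist A j y) / 2"
proof -
  have "midpoint x y = (1 / 2) *\<^sub>R x + (1 / 2) *\<^sub>R y"
    by (simp add: midpoint_def scaleR_right_distrib)
  then show ?thesis
    using signed_dist_affine[of "1 / 2" "1 / 2" A j x y] by simp
qed

lemma signed_dist_inner:
  "signed_dist A j x = inner (\<i> * edge_dir A j) x - inner (\<i> * edge_dir A j) (A j)"
  by (simp add: signed_dist_def inner_complex_def algebra_simps)

lemma continuous_signed_dist: "continuous_on S (signed_dist A j)"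
  unfolding signed_dist_def by (intro continuous_intros)

lemma infdist_side_line:
  "A (Suc j) \<noteq> A j \<Longrightarrow> infdist x (side_line A j) = \<bar>signed_dist A j x\<bar>"
  unfolding side_line_def signed_dist_def edge_dir_def by (rule infdist_line) auto

lemma signed_dist_ends [simp]:
  "signed_dist A j (A j) = 0" "signed_dist A j (A (Suc j)) = 0"
proof -
  have "cnj (sgn z) * z = of_real (norm z)" for z :: complex
    using complex_norm_square[of z]
    by (cases "z = 0") (simp_all add: sgn_eq field_simps power2_eq_square mult.commute)
  then show "signed_dist A j (A (Suc j)) = 0"
    by (simp add: signed_dist_def edge_dir_def)
qed (simp add: signed_dist_def)

lemma Suc_mod_eq_iff: "Suc i mod n = Suc j mod n \<longleftrightarrow> i mod n = j mod n"
  by (cases "n = 0") (auto simp: mod_Suc split: if_splits)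

lemma add_mod_neq: "0 < k \<Longrightarrow> k < n \<Longrightarrow> (j + k) mod n \<noteq> j mod n" for k n :: nat
  by (metis add_diff_cancel_left' le_add1 mod_eq_dvd_iff_nat nat_dvd_not_less)

section \<open>Vertices and sides of a convex polygon\<close>

locale ngon =
  fixes n :: nat and A :: "nat \<Rightarrow> complex"
  assumes convex_ngon: "convex_ngon n A"
begin

lemma n_ge_3: "3 \<le> n" and n_pos: "0 < n"
  using convex_ngon by (auto simp: convex_ngon_def)

lemma periodic_A: "periodic n A"
  using convex_ngon by (auto simp: convex_ngon_def)

lemma A_shift [simp]: "A (i + n) = A i" "A (Suc (i + n)) = A (Suc i)"
  using periodic_A by (auto simp: periodic_def simp flip: add_Suc)

lemma ex_index:
  obtains k where "k \<in> {1..n}" "A k = A i" "k mod n = i mod n"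
proof (cases "i mod n = 0")
  case True
  then show thesis
    using that[of n] n_pos periodic_cong[OF periodic_A, of n i] by auto
next
  case False
  then show thesis
    using that[of "i mod n"] n_pos periodic_cong[OF periodic_A, of "i mod n" i]
    by (auto simp: less_imp_le)
qed

lemma A_eq_iff: "A i = A j \<longleftrightarrow> i mod n = j mod n"
proof
  assume eq: "A i = A j"
  obtain k where k: "k \<in> {1..n}" "A k = A i" "k mod n = i mod n" by (rule ex_index)
  obtain l where l: "l \<in> {1..n}" "A l = A j" "l mod n = j mod n" by (rule ex_index)
  have "inj_on A {1..n}"
    using convex_ngon by (simp add: convex_ngon_def)
  then have "k = l"
    using k l eq inj_onD[of A "{1..n}" k l] by simp
  with k l show "i mod n = j mod n" by simp
next
  assume "i mod n = j mod n"
  then show "A i = A j"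
    by (rule periodic_cong[OF periodic_A])
qed

lemma A_Suc_neq: "A (Suc j) \<noteq> A j"
  using add_mod_neq[of 1 n j] n_ge_3 by (simp add: A_eq_iff)

lemma A_in_polygon: "A i \<in> polygon_of n A"
  using convex_ngon by (auto simp: convex_ngon_def extreme_point_of_def)

lemma signed_dist_shift:
  "signed_dist A (j + n) = signed_dist A j" "signed_dist A (Suc (j + n)) = signed_dist A (Suc j)"
  using A_shift(1)[of "Suc (Suc j)"] by (simp_all add: signed_dist_def edge_dir_def fun_eq_iff)

lemma convex_polygon_of: "convex (polygon_of n A)"
  by (simp add: polygon_of_def)

lemma norm_edge_dir: "norm (edge_dir A j) = 1"
  using A_Suc_neq by (simp add: edge_dir_def norm_sgn)

lemma signed_dist_eq:
  "signed_dist A j x = Im (cnj (A (Suc j) - A j) * (x - A j)) / norm (A (Suc j) - A j)"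
  unfolding signed_dist_def edge_dir_def sgn_eq
  by (simp only: complex_cnj_divide complex_cnj_complex_of_real times_divide_eq_left Im_divide_of_real)

lemma signed_dist_nonneg: "x \<in> polygon_of n A \<Longrightarrow> 0 \<le> signed_dist A j x"
  using convex_ngon by (simp add: signed_dist_eq convex_ngon_def)

lemma infdist_eq_signed_dist:
  "x \<in> polygon_of n A \<Longrightarrow> infdist x (side_line A j) = signed_dist A j x"
  using infdist_side_line[of A j x] A_Suc_neq[of j] signed_dist_nonneg[of x j] by simp

text \<open>Distance zero would make three distinct vertices collinear, and the middle one would not
  be an extreme point.\<close>

lemma signed_dist_vertex_pos:
  assumes "k mod n \<noteq> j mod n" "k mod n \<noteq> Suc j mod n"
  shows "0 < signed_dist A j (A k)"
proof (rule ccontr)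
  have ex: "A i \<notin> open_segment (A k) (A l)" for i k l
    using convex_ngon A_in_polygon by (auto simp: convex_ngon_def extreme_point_of_def)
  assume "\<not> ?thesis"
  then have "signed_dist A j (A k) = 0"
    using signed_dist_nonneg[OF A_in_polygon, of j k] by simp
  then have "collinear {A j, A (Suc j), A k}"
    using A_Suc_neq by (simp add: signed_dist_eq collinear_iff_cross)
  moreover have "A k \<noteq> A j" "A k \<noteq> A (Suc j)" "A (Suc j) \<noteq> A j"
    using assms A_Suc_neq by (simp_all add: A_eq_iff)
  ultimately show False
    using ex[of j "Suc j" k] ex[of "Suc j" k j] ex[of k j "Suc j"]
    unfolding collinear_between_cases between_mem_segment open_segment_def by auto
qed

text \<open>The distance of \<open>A j\<close> from side line \<open>Suc j\<close> is positive and
  equals the length of side \<open>j\<close> times the sine of the turn.\<close>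

lemma turn_pos: "0 < Im (turn A j)"
proof -
  have "0 < signed_dist A (Suc j) (A j)"
    using add_mod_neq[of 1 n j] add_mod_neq[of 2 n j] n_ge_3
    by (intro signed_dist_vertex_pos) auto
  moreover have eq: "A j - A (Suc j) = - (of_real (norm (A (Suc j) - A j)) * edge_dir A j)"
    using A_Suc_neq by (simp add: edge_dir_def sgn_eq)
  have "signed_dist A (Suc j) (A j) = norm (A (Suc j) - A j) * Im (turn A j)"
    unfolding signed_dist_def eq by (simp add: turn_def algebra_simps)
  ultimately show ?thesis
    using A_Suc_neq by (simp add: zero_less_mult_iff)
qed

text \<open>The ends of side \<open>i\<close> cannot both lie on another side line. Midpoints later
  serve as witnesses that tell the cells apart.\<close>

lemma signed_dist_midpoint_pos:
  assumes "i mod n \<noteq> j mod n"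
  shows "0 < signed_dist A j (midpoint (A i) (A (Suc i)))"
proof -
  have "signed_dist A j (midpoint (A i) (A (Suc i))) =
      (signed_dist A j (A i) + signed_dist A j (A (Suc i))) / 2"
    by (rule signed_dist_midpoint)
  moreover have "0 < signed_dist A j (A i) \<or> 0 < signed_dist A j (A (Suc i))"
  proof (cases "i mod n = Suc j mod n")
    case True
    then have "Suc i mod n = Suc (Suc j) mod n"
      by (simp add: Suc_mod_eq_iff)
    then have "Suc i mod n \<noteq> j mod n"
      using add_mod_neq[of 2 n j] n_ge_3 by simp
    then show ?thesis
      using assms signed_dist_vertex_pos[of "Suc i" j] by (simp add: Suc_mod_eq_iff)
  next
    case False
    then show ?thesis
      using assms signed_dist_vertex_pos[of i j] by simp
  qed
  ultimately show ?thesis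
    using signed_dist_nonneg[OF A_in_polygon, of j i] signed_dist_nonneg[OF A_in_polygon, of j "Suc i"]
    by auto
qed

lemma midpoint_in_polygon: "midpoint (A i) (A (Suc i)) \<in> polygon_of n A"
  using closed_segment_subset[OF A_in_polygon A_in_polygon convex_polygon_of, of i "Suc i"]
    midpoint_in_closed_segment by blast

lemma interior_polygon_nonempty: "interior (polygon_of n A) \<noteq> {}"
proof -
  have "0 < signed_dist A 0 (A 2)"
    using n_ge_3 by (intro signed_dist_vertex_pos) auto
  then have "\<not> collinear {A 0, A 1, A 2}"
    using A_Suc_neq by (auto simp: signed_dist_eq collinear_iff_cross)
  moreover from this have "card {A 0, A 1, A 2} = 3"
    by (auto simp: card_insert_if insert_commute)
  ultimately have "interior (convex hull {A 0, A 1, A 2}) \<noteq> {}"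
    by (subst interior_convex_hull_eq_empty) (auto simp: collinear_3_eq_affine_dependent)
  moreover have "convex hull {A 0, A 1, A 2} \<subseteq> polygon_of n A"
    using A_in_polygon convex_polygon_of by (intro hull_minimal) auto
  ultimately show ?thesis
    using interior_mono by blast
qed

end

section \<open>Cells for positive periodic weights\<close>

locale weighted_ngon = ngon +
  fixes q :: "nat \<Rightarrow> real"
  assumes q_pos: "0 < q j" and q_periodic: "periodic n q"
begin

lemma weighted_dist_mod: "i mod n = j mod n \<Longrightarrow> q i * signed_dist A i x = q j * signed_dist A j x"
proof -
  assume ij: "i mod n = j mod n"
  have "q i = q j"
    using q_periodic ij by (rule periodic_cong)
  moreover have "A i = A j" "A (Suc i) = A (Suc j)"
    using ij by (auto simp: A_eq_iff Suc_mod_eq_iff)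
  ultimately show ?thesis
    by (simp add: signed_dist_def edge_dir_def)
qed

lemma all_weighted_dist:
  "(\<forall>j\<in>{1..n}. c \<le> q j * signed_dist A j x) \<longleftrightarrow> (\<forall>j. c \<le> q j * signed_dist A j x)"
proof (intro iffI allI)
  fix j assume P: "\<forall>j\<in>{1..n}. c \<le> q j * signed_dist A j x"
  obtain k where "k \<in> {1..n}" "k mod n = j mod n" by (rule ex_index)
  with P show "c \<le> q j * signed_dist A j x"
    using weighted_dist_mod[of k j x] by metis
qed auto

lemma cell_eq_weighted_cell:
  assumes "\<And>j. j \<in> {1..n} \<Longrightarrow> p j = q j" "i \<in> {1..n}"
  shows "cell n A p i = weighted_cell n A q i"
proof -
  have "cell n A p i = {x \<in> polygon_of n A. \<forall>j\<in>{1..n}. q i * signed_dist A i x \<le> q j * signed_dist A j x}"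
    using assms by (auto simp: cell_def infdist_eq_signed_dist)
  then show ?thesis
    unfolding weighted_cell_def all_weighted_dist .
qed

lemma weighted_cell_polytope: "polytope (weighted_cell n A q i)"
proof -
  let ?H = "\<lambda>j. {x. q i * signed_dist A i x \<le> q j * signed_dist A j x}"
  have "weighted_cell n A q i = polygon_of n A \<inter> \<Inter> (?H ` {1..n})"
    using all_weighted_dist[of "q i * signed_dist A i x" x for x] unfolding weighted_cell_def by blast
  moreover have "polyhedron (?H j)" for j
  proof -
    let ?a = "q i *\<^sub>R (\<i> * edge_dir A i) - q j *\<^sub>R (\<i> * edge_dir A j)"
    let ?b = "q i * inner (\<i> * edge_dir A i) (A i) - q j * inner (\<i> * edge_dir A j) (A j)"
    have "?H j = {x. inner ?a x \<le> ?b}"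
      unfolding signed_dist_inner inner_diff_left inner_scaleR_left by (auto simp only: right_diff_distrib)
    then show ?thesis
      using polyhedron_halfspace_le[of ?a ?b] by simp
  qed
  moreover have "polytope (polygon_of n A)"
    by (simp add: polygon_of_def polytope_convex_hull finite_imp_compact)
  ultimately show ?thesis
    by (auto intro!: polytope_Int_polyhedron polyhedron_Inter)
qed

text \<open>The midpoint of side \<open>i\<close> satisfies every competing inequality strictly. It
  lies in the closure of the interior of the polygon, so the open set \<open>?W\<close> meets that
  interior.\<close>

lemma weighted_cell_interior: "interior (weighted_cell n A q i) \<noteq> {}"
proof -
  let ?m = "midpoint (A i) (A (Suc i))"
  let ?W = "\<Inter>j\<in>{j \<in> {1..n}. j mod n \<noteq> i mod n}. {x. q i * signed_dist A i x < q j * signed_dist A j x}"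
  have W: "open ?W"
    by (intro open_INT ballI open_Collect_less continuous_intros continuous_signed_dist) auto
  have "signed_dist A i ?m = 0"
    by (simp add: signed_dist_midpoint)
  then have "?m \<in> ?W"
    using signed_dist_midpoint_pos q_pos by auto
  moreover have "?m \<in> closure (interior (polygon_of n A))"
    using convex_closure_interior[OF convex_polygon_of interior_polygon_nonempty]
      midpoint_in_polygon closure_subset by blast
  ultimately have "?W \<inter> interior (polygon_of n A) \<noteq> {}"
    using W open_Int_closure_eq_empty by blast
  moreover have "?W \<inter> interior (polygon_of n A) \<subseteq> weighted_cell n A q i"
  proof
    fix x assume x: "x \<in> ?W \<inter> interior (polygon_of n A)"
    have "q i * signed_dist A i x \<le> q j * signed_dist A j x" for j
    proof -
      obtain k where k: "k \<in> {1..n}" "k mod n = j mod n" by (rule ex_index)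
      show ?thesis
        using x k weighted_dist_mod[of k j x] weighted_dist_mod[of j i x]
        by (cases "j mod n = i mod n") force+
    qed
    then show "x \<in> weighted_cell n A q i"
      using x interior_subset unfolding weighted_cell_def by blast
  qed
  ultimately show ?thesis
    using interior_maximal[OF _ open_Int[OF W open_interior]] by blast
qed

lemma base_in_weighted_cell: "closed_segment (A i) (A (Suc i)) \<subseteq> weighted_cell n A q i"
proof
  fix x assume x: "x \<in> closed_segment (A i) (A (Suc i))"
  then have D: "x \<in> polygon_of n A"
    using closed_segment_subset[OF A_in_polygon A_in_polygon convex_polygon_of] by blast
  obtain u where "x = (1 - u) *\<^sub>R A i + u *\<^sub>R A (Suc i)"
    using x by (auto simp: closed_segment_def)
  then have "signed_dist A i x = 0"
    by (simp add: signed_dist_affine)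
  with D show "x \<in> weighted_cell n A q i"
    using signed_dist_nonneg q_pos by (simp add: weighted_cell_def less_imp_le)
qed

lemma weighted_cells_cover: "(\<Union>i\<in>{1..n}. weighted_cell n A q i) = polygon_of n A"
proof
  show "polygon_of n A \<subseteq> (\<Union>i\<in>{1..n}. weighted_cell n A q i)"
  proof
    fix x assume x: "x \<in> polygon_of n A"
    let ?f = "\<lambda>j. q j * signed_dist A j x"
    obtain i where i: "i \<in> {1..n}" and "\<forall>k\<in>{1..n}. ?f i \<le> ?f k"
      using ex_min_if_finite[of "?f ` {1..n}"] n_pos by (force simp: not_less)
    then have "\<forall>j. ?f i \<le> ?f j"
      unfolding all_weighted_dist by blast
    with i x show "x \<in> (\<Union>i\<in>{1..n}. weighted_cell n A q i)"
      by (auto simp: weighted_cell_def)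
  qed
qed (auto simp: weighted_cell_def)

text \<open>The overlap lies in the zero set of an affine function. The midpoint of side
  \<open>i\<close> is outside that set, which is therefore a line or, if \<open>?a = 0\<close>,
  empty.\<close>

lemma weighted_cells_interiors:
  assumes "i mod n \<noteq> j mod n"
  shows "interior (weighted_cell n A q i) \<inter> interior (weighted_cell n A q j) = {}"
proof -
  let ?a = "q i *\<^sub>R (\<i> * edge_dir A i) - q j *\<^sub>R (\<i> * edge_dir A j)"
  let ?b = "q i * inner (\<i> * edge_dir A i) (A i) - q j * inner (\<i> * edge_dir A j) (A j)"
  have eq: "q i * signed_dist A i x - q j * signed_dist A j x = inner ?a x - ?b" for x
    unfolding signed_dist_inner inner_diff_left inner_scaleR_left by (simp only: right_diff_distrib)
  let ?m = "midpoint (A i) (A (Suc i))"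
  have "signed_dist A i ?m = 0"
    by (simp add: signed_dist_midpoint)
  then have "inner ?a ?m \<noteq> ?b"
    using eq[of ?m] signed_dist_midpoint_pos[OF assms] q_pos[of j]
    by (metis diff_0_eq_0 diff_self less_irrefl mult_eq_0_iff mult_zero_right eq_iff_diff_eq_0)
  then have "interior {x. inner ?a x = ?b} = {}"
    by (cases "?a = 0") auto
  moreover have "weighted_cell n A q i \<inter> weighted_cell n A q j \<subseteq> {x. inner ?a x = ?b}"
  proof
    fix x assume "x \<in> weighted_cell n A q i \<inter> weighted_cell n A q j"
    then have "q i * signed_dist A i x - q j * signed_dist A j x = 0"
      by (auto simp: weighted_cell_def intro: antisym)
    then show "x \<in> {x. inner ?a x = ?b}"
      unfolding eq by simp
  qed
  ultimately show ?thesis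
    using interior_mono by (metis interior_Int subset_empty)
qed

end

text \<open>Each side of the triangle is a zero set of an affine function that is nonnegative on the
  cell: the distance to the base, or its difference with the weighted distance to a neighbouring
  side.\<close>

lemma (in weighted_ngon) weighted_cell_in_tri:
  assumes pos: "0 < signed_dist A (Suc j) V"
    and left: "q j * signed_dist A j V = q (Suc j) * signed_dist A (Suc j) V"
    and right: "q (Suc j) * signed_dist A (Suc j) V = q (Suc (Suc j)) * signed_dist A (Suc (Suc j)) V"
  shows "weighted_cell n A q (Suc j) \<subseteq> convex hull {A (Suc j), A (Suc (Suc j)), V}"
proof
  fix x assume x: "x \<in> weighted_cell n A q (Suc j)"
  let ?P = "A (Suc j)" and ?Q = "A (Suc (Suc j))"
  let ?d = "\<lambda>k. signed_dist A k"
  have "Im (cnj (?Q - ?P) * (V - ?P)) \<noteq> 0"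
    using pos by (auto simp: signed_dist_eq)
  then obtain u v w where uvw: "u + v + w = 1" and x_eq: "x = u *\<^sub>R ?P + v *\<^sub>R ?Q + w *\<^sub>R V"
    by (rule barycentric)
  have d: "?d k x = u * ?d k ?P + v * ?d k ?Q + w * ?d k V" for k
    unfolding x_eq using uvw by (rule signed_dist_affine3)
  have PQ: "0 < ?d (Suc (Suc j)) ?P" "0 < ?d j ?Q"
    using add_mod_neq[of 1 n j] add_mod_neq[of 2 n j] n_ge_3
    by (auto intro!: signed_dist_vertex_pos simp: Suc_mod_eq_iff)
  have D: "x \<in> polygon_of n A"
    using x by (simp add: weighted_cell_def)
  have "0 \<le> w"
    using signed_dist_nonneg[OF D, of "Suc j"] pos by (simp add: d zero_le_mult_iff)
  moreover have "0 \<le> v"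
  proof -
    have "q (Suc j) * ?d (Suc j) x \<le> q j * ?d j x"
      using x by (simp add: weighted_cell_def)
    then have "w * (q (Suc j) * ?d (Suc j) V) \<le> v * (q j * ?d j ?Q) + w * (q j * ?d j V)"
      by (simp add: d algebra_simps)
    then have "0 \<le> v * (q j * ?d j ?Q)"
      unfolding left by simp
    then show ?thesis
      using mult_pos_pos[OF q_pos[of j] PQ(2)] by (metis linorder_not_le mult_neg_pos)
  qed
  moreover have "0 \<le> u"
  proof -
    have "q (Suc j) * ?d (Suc j) x \<le> q (Suc (Suc j)) * ?d (Suc (Suc j)) x"
      using x by (simp add: weighted_cell_def)
    then have "w * (q (Suc j) * ?d (Suc j) V) \<le>
        u * (q (Suc (Suc j)) * ?d (Suc (Suc j)) ?P) + w * (q (Suc (Suc j)) * ?d (Suc (Suc j)) V)"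
      by (simp add: d algebra_simps)
    then have "0 \<le> u * (q (Suc (Suc j)) * ?d (Suc (Suc j)) ?P)"
      unfolding right by simp
    then show ?thesis
      using mult_pos_pos[OF q_pos[of "Suc (Suc j)"] PQ(1)] by (metis linorder_not_le mult_neg_pos)
  qed
  ultimately show "x \<in> convex hull {?P, ?Q, V}"
    using uvw x_eq unfolding convex_hull_3 by blast
qed

section \<open>Triangle systems in logarithmic weight ratios\<close>

text \<open>A ray from the vertex \<open>A (Suc j)\<close> is described by the logarithm \<open>t\<close> of the ratio of the
  distances of its points from the lines \<open>j\<close> and \<open>Suc j\<close>. If \<open>w\<close> is the turn at that vertex, then
  \<open>ray_cot w t\<close> and \<open>ray_cot w (- t)\<close> are the cotangents of the angles between the ray and the
  sides \<open>Suc j\<close> and \<open>j\<close>.\<close>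

definition ray_cot :: "complex \<Rightarrow> real \<Rightarrow> real" where
  "ray_cot w t = (exp t - Re w) / Im w"

text \<open>\<open>x\<close> belongs to the ray at \<open>A (Suc j)\<close> and \<open>y\<close> to
  the ray at \<open>A (Suc (Suc j))\<close>, the two ends of the base. The sum of the base
  cotangents is base length divided by height.\<close>

definition cot_sum :: "(nat \<Rightarrow> complex) \<Rightarrow> nat \<Rightarrow> real \<Rightarrow> real \<Rightarrow> real" where
  "cot_sum A j x y = ray_cot (turn A j) x + ray_cot (turn A (Suc j)) (- y)"

text \<open>With base length \<open>b\<close> the area is
  \<open>b\<^sup>2 / (2 * cot_sum A j x y)\<close>, so this is half the quotient of apex angle and
  area.\<close>

definition angle_area_ratio :: "(nat \<Rightarrow> complex) \<Rightarrow> nat \<Rightarrow> real \<Rightarrow> real \<Rightarrow> real" where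
  "angle_area_ratio A j x y =
     (arctan (ray_cot (turn A j) x) + arctan (ray_cot (turn A (Suc j)) (- y))) * cot_sum A j x y /
     (norm (A (Suc (Suc j)) - A (Suc j)))\<^sup>2"

text \<open>The meeting point of the two rays, in coordinates with origin \<open>A (Suc j)\<close>
  and first axis along side \<open>Suc j\<close>.\<close>

definition apex :: "(nat \<Rightarrow> complex) \<Rightarrow> nat \<Rightarrow> real \<Rightarrow> real \<Rightarrow> complex" where
  "apex A j x y = A (Suc j) + edge_dir A (Suc j) *
     Complex (ray_cot (turn A j) x * (norm (A (Suc (Suc j)) - A (Suc j)) / cot_sum A j x y))
       (norm (A (Suc (Suc j)) - A (Suc j)) / cot_sum A j x y)"

text \<open>Scaled so that the parameter along the ray is the distance from side line
  \<open>Suc j\<close>.\<close>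

definition ray_dir :: "(nat \<Rightarrow> complex) \<Rightarrow> nat \<Rightarrow> real \<Rightarrow> complex" where
  "ray_dir A j x = edge_dir A (Suc j) * Complex (ray_cot (turn A j) x) 1"

text \<open>Index \<open>j\<close> belongs to the ray at \<open>A (Suc j)\<close>, so that weights
  satisfy \<open>p (Suc j) = p j * exp (t j)\<close>. For normalized systems,
  \<open>log_ratio_previous\<close> yields the same value from the apex \<open>V j\<close>.\<close>

definition log_ratio :: "(nat \<Rightarrow> complex) \<Rightarrow> (nat \<Rightarrow> complex) \<Rightarrow> nat \<Rightarrow> real" where
  "log_ratio A V j = ln (signed_dist A j (V (Suc j)) / signed_dist A (Suc j) (V (Suc j)))"

lemma ray_cot_strict_mono: "0 < Im w \<Longrightarrow> x < y \<Longrightarrow> ray_cot w x < ray_cot w y"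
  by (simp add: ray_cot_def divide_strict_right_mono)

lemma ray_cot_mono: "0 < Im w \<Longrightarrow> x \<le> y \<Longrightarrow> ray_cot w x \<le> ray_cot w y"
  by (simp add: ray_cot_def divide_right_mono)

lemma angle_area_ratio_strict_mono:
  assumes turn: "0 < Im (turn A j)" "0 < Im (turn A (Suc j))" and side: "A (Suc (Suc j)) \<noteq> A (Suc j)"
    and pos: "0 < cot_sum A j x y" and xy: "x \<le> x'" "y' \<le> y" "x < x' \<or> y' < y"
  shows "angle_area_ratio A j x y < angle_area_ratio A j x' y'"
proof -
  let ?B = "ray_cot (turn A j)" and ?C = "ray_cot (turn A (Suc j))"
  have le: "?B x \<le> ?B x'" "?C (- y) \<le> ?C (- y')"
    using turn xy by (auto intro: ray_cot_mono)
  moreover have "?B x < ?B x' \<or> ?C (- y) < ?C (- y')"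
    using xy(3) ray_cot_strict_mono[OF turn(1), of x x'] ray_cot_strict_mono[OF turn(2), of "- y" "- y'"] by auto
  ultimately have sum: "cot_sum A j x y < cot_sum A j x' y'"
    by (auto simp: cot_sum_def)
  have ang: "arctan (?B x) + arctan (?C (- y)) \<le> arctan (?B x') + arctan (?C (- y'))"
    using le by (intro add_mono) (auto simp: arctan_le_iff)
  \<comment> \<open>A positive angle is needed for the product of angle and cotangent sum to grow
    strictly.\<close>
  have "arctan (- ?C (- y)) < arctan (?B x)"
    using pos by (simp only: arctan_less_iff) (simp add: cot_sum_def)
  then have ang_pos: "0 < arctan (?B x) + arctan (?C (- y))"
    by (simp add: arctan_minus)
  have "(arctan (?B x) + arctan (?C (- y))) * cot_sum A j x y
      < (arctan (?B x') + arctan (?C (- y'))) * cot_sum A j x' y'"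
    using ang_pos ang sum pos by (intro mult_le_less_imp_less) auto
  then show ?thesis
    unfolding angle_area_ratio_def using side
    by (intro divide_strict_right_mono) auto
qed

section \<open>Triangles in the frame of their base\<close>

context ngon
begin

lemma norm_turn: "norm (turn A j) = 1"
  by (simp add: turn_def norm_mult norm_edge_dir)

lemma turn_squares: "(Re (turn A j))\<^sup>2 + (Im (turn A j))\<^sup>2 = 1"
  using norm_turn[of j] by (simp add: cmod_power2[symmetric])

lemma edge_dir_cnj: "cnj (edge_dir A j) * edge_dir A j = 1"
  using complex_norm_square[of "edge_dir A j"] norm_edge_dir[of j] by (simp add: mult.commute)

lemma edge_length_pos: "0 < norm (A (Suc j) - A j)"
  using A_Suc_neq[of j] by simp

lemma edge_step: "A (Suc j) = A j + of_real (norm (A (Suc j) - A j)) * edge_dir A j"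
  using A_Suc_neq[of j] by (simp add: edge_dir_def sgn_eq)

lemma edge_dir_Suc: "edge_dir A (Suc j) = edge_dir A j * turn A j"
  using edge_dir_cnj[of j] by (simp add: turn_def mult.assoc[symmetric] mult.commute)

text \<open>The frame has origin \<open>A (Suc j)\<close> and first axis along side
  \<open>Suc j\<close>; the neighbouring side lines are inclined to it by the two adjacent
  turns.\<close>

lemma signed_dist_frame:
  fixes X Y :: real
  assumes "z = A (Suc j) + edge_dir A (Suc j) * Complex X Y"
  shows "signed_dist A (Suc j) z = Y"
    and "signed_dist A j z = Im (turn A j) * X + Re (turn A j) * Y"
    and "signed_dist A (Suc (Suc j)) z = Re (turn A (Suc j)) * Y
      + Im (turn A (Suc j)) * (norm (A (Suc (Suc j)) - A (Suc j)) - X)"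
proof -
  let ?b = "norm (A (Suc (Suc j)) - A (Suc j))"
  have "cnj (edge_dir A (Suc j)) * (z - A (Suc j)) = Complex X Y"
    unfolding assms using edge_dir_cnj[of "Suc j"] by (simp add: mult.assoc[symmetric])
  then show "signed_dist A (Suc j) z = Y"
    by (simp add: signed_dist_def)
  have "cnj (edge_dir A j) * (z - A j) =
      turn A j * Complex X Y + of_real (norm (A (Suc j) - A j)) * (cnj (edge_dir A j) * edge_dir A j)"
    unfolding assms by (subst edge_step) (simp add: turn_def algebra_simps)
  then show "signed_dist A j z = Im (turn A j) * X + Re (turn A j) * Y"
    unfolding edge_dir_cnj signed_dist_def by simp
  have "z - A (Suc (Suc j)) = edge_dir A (Suc j) * Complex (X - ?b) Y"
    unfolding assms by (subst (2) edge_step) (simp add: complex_eq_iff algebra_simps)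
  then have "cnj (edge_dir A (Suc (Suc j))) * (z - A (Suc (Suc j))) =
      cnj (turn A (Suc j)) * Complex (X - ?b) Y"
    by (simp add: turn_def mult_ac)
  then show "signed_dist A (Suc (Suc j)) z = Re (turn A (Suc j)) * Y + Im (turn A (Suc j)) * (?b - X)"
    unfolding signed_dist_def by (simp add: algebra_simps)
qed

lemma exp_eq_ray_cot: "exp x = Re (turn A j) + Im (turn A j) * ray_cot (turn A j) x"
  using turn_pos[of j] by (simp add: ray_cot_def)

lemma ray_cot_ln:
  assumes "0 < Y" "0 < Im (turn A j) * X + Re (turn A j) * Y"
  shows "ray_cot (turn A j) (ln ((Im (turn A j) * X + Re (turn A j) * Y) / Y)) = X / Y"
  using assms turn_pos[of j] by (simp add: ray_cot_def field_simps)

text \<open>In the frame of the base, of length \<open>b\<close>, the ratios fix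
  \<open>X / Y\<close> and \<open>(b - X) / Y\<close>. Their sum is \<open>b / Y\<close>, which
  gives the height and hence the point.\<close>

lemma apex_unique:
  fixes V :: complex
  assumes "0 < signed_dist A j V" "0 < signed_dist A (Suc j) V" "0 < signed_dist A (Suc (Suc j)) V"
    and x: "x = ln (signed_dist A j V / signed_dist A (Suc j) V)"
    and y: "y = ln (signed_dist A (Suc j) V / signed_dist A (Suc (Suc j)) V)"
  shows "0 < cot_sum A j x y" "V = apex A j x y"
proof -
  let ?b = "norm (A (Suc (Suc j)) - A (Suc j))"
  define X where "X = Re (cnj (edge_dir A (Suc j)) * (V - A (Suc j)))"
  define Y where "Y = Im (cnj (edge_dir A (Suc j)) * (V - A (Suc j)))"
  have "V - A (Suc j) = (cnj (edge_dir A (Suc j)) * edge_dir A (Suc j)) * (V - A (Suc j))"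
    by (simp add: edge_dir_cnj)
  also have "\<dots> = edge_dir A (Suc j) * Complex X Y"
    by (simp only: X_def Y_def complex_surj mult_ac)
  finally have V: "V = A (Suc j) + edge_dir A (Suc j) * Complex X Y"
    by (simp add: algebra_simps)
  note d = signed_dist_frame[OF V]
  have Y: "0 < Y"
    using assms(2) d(1) by simp
  have B: "ray_cot (turn A j) x = X / Y"
    unfolding x d(1,2) using assms(1) Y d by (intro ray_cot_ln) auto
  have "- y = ln (signed_dist A (Suc (Suc j)) V / Y)"
    using assms(3) Y d(1) by (simp add: y ln_div)
  also have "\<dots> = ln ((Im (turn A (Suc j)) * (?b - X) + Re (turn A (Suc j)) * Y) / Y)"
    unfolding d(3) by (simp add: add.commute)
  finally have "ray_cot (turn A (Suc j)) (- y) = (?b - X) / Y"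
    using ray_cot_ln[of Y "Suc j" "?b - X"] Y assms(3) d(3) by (simp add: add.commute)
  with B have sum: "cot_sum A j x y = ?b / Y"
    by (simp add: cot_sum_def flip: add_divide_distrib)
  then show "0 < cot_sum A j x y"
    using Y edge_length_pos[of "Suc j"] by simp
  have "?b / cot_sum A j x y = Y"
    using sum Y edge_length_pos[of "Suc j"] by simp
  then show "V = apex A j x y"
    unfolding apex_def B using V Y by simp
qed

lemma apex_distances:
  assumes "0 < cot_sum A j x y"
  defines "Y \<equiv> norm (A (Suc (Suc j)) - A (Suc j)) / cot_sum A j x y"
  shows "0 < Y" "signed_dist A (Suc j) (apex A j x y) = Y"
    and "signed_dist A j (apex A j x y) = exp x * Y"
    and "signed_dist A (Suc (Suc j)) (apex A j x y) = exp (- y) * Y"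
proof -
  let ?b = "norm (A (Suc (Suc j)) - A (Suc j))"
  show Y: "0 < Y"
    using assms edge_length_pos[of "Suc j"] by (simp add: Y_def)
  have b: "?b - ray_cot (turn A j) x * Y = ray_cot (turn A (Suc j)) (- y) * Y"
  proof -
    have "?b = cot_sum A j x y * Y"
      using assms(1) by (simp add: Y_def)
    then show ?thesis
      by (simp add: cot_sum_def algebra_simps)
  qed
  have V: "apex A j x y = A (Suc j) + edge_dir A (Suc j) * Complex (ray_cot (turn A j) x * Y) Y"
    by (simp add: apex_def Y_def)
  note d = signed_dist_frame[OF V]
  show "signed_dist A (Suc j) (apex A j x y) = Y"
    by (fact d(1))
  show "signed_dist A j (apex A j x y) = exp x * Y"
    unfolding d(2) exp_eq_ray_cot[of x j] by (simp add: algebra_simps)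
  show "signed_dist A (Suc (Suc j)) (apex A j x y) = exp (- y) * Y"
    unfolding d(3) b exp_eq_ray_cot[of "- y" "Suc j"] by (simp add: algebra_simps)
qed

lemma apex_ratio:
  assumes "0 < cot_sum A j x y"
  shows "vertex_angle (A (Suc j)) (apex A j x y) (A (Suc (Suc j))) /
    measure lebesgue (convex hull {A (Suc j), A (Suc (Suc j)), apex A j x y}) = 2 * angle_area_ratio A j x y"
proof -
  let ?b = "norm (A (Suc (Suc j)) - A (Suc j))"
  define Y where "Y = ?b / cot_sum A j x y"
  note d = apex_distances[OF assms, folded Y_def]
  have b: "?b = cot_sum A j x y * Y"
    using assms by (simp add: Y_def)
  have "vertex_angle (A (Suc j)) (apex A j x y) (A (Suc (Suc j))) =
      arctan (ray_cot (turn A j) x) + arctan (ray_cot (turn A (Suc j)) (- y))"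
  proof (rule vertex_angle_frame[OF norm_edge_dir[of "Suc j"] d(1)])
    show "apex A j x y = A (Suc j) + edge_dir A (Suc j) * Complex (ray_cot (turn A j) x * Y) Y"
      by (simp add: apex_def Y_def)
    show "A (Suc (Suc j)) = A (Suc j) + edge_dir A (Suc j) *
        of_real ((ray_cot (turn A j) x + ray_cot (turn A (Suc j)) (- y)) * Y)"
      using edge_step[of "Suc j"] b by (simp add: cot_sum_def mult.commute)
  qed (use assms in \<open>simp add: cot_sum_def\<close>)
  moreover have "Im (cnj (A (Suc (Suc j)) - A (Suc j)) * (apex A j x y - A (Suc j))) = ?b * Y"
    using d(2) edge_length_pos[of "Suc j"] unfolding signed_dist_eq by (simp add: divide_eq_eq mult.commute)
  then have "measure lebesgue (convex hull {A (Suc j), A (Suc (Suc j)), apex A j x y}) =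
      ?b\<^sup>2 / (2 * cot_sum A j x y)"
    unfolding measure_triangle_complex using assms edge_length_pos[of "Suc j"]
    by (simp add: Y_def power2_eq_square)
  ultimately show ?thesis
    by (simp add: angle_area_ratio_def)
qed

end

section \<open>Normalized systems: weights, cells and uniqueness\<close>

lemma sum_lessThan_period:
  fixes t :: "nat \<Rightarrow> real"
  assumes "periodic n t" "(\<Sum>j<n. t j) = 0"
  shows "(\<Sum>j<i + n. t j) = (\<Sum>j<i. t j)"
  by (induction i) (use assms in \<open>auto simp: periodic_def\<close>)

text \<open>The disc of radius \<open>\<rho>\<close> lies strictly inside all side lines. This
  positivity gives meaning to the logarithms of distance ratios of the apices.\<close>

locale deep_ngon = ngon +
  fixes \<rho> :: real
  assumes deep: "norm z < \<rho> \<Longrightarrow> 0 < signed_dist A j z"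

locale normalized_ngon = deep_ngon +
  fixes V :: "nat \<Rightarrow> complex"
  assumes normalized: "normalized_system n \<rho> A V"
begin

abbreviation "t \<equiv> log_ratio A V"

lemma V_shift [simp]: "V (i + n) = V i" "V (Suc (i + n)) = V (Suc i)"
  using normalized by (auto simp: normalized_system_def admissible_def periodic_def simp flip: add_Suc)

lemma V_dist_pos: "0 < signed_dist A j (V i)"
  using normalized by (intro deep) (simp add: normalized_system_def)

lemma V_infdist: "infdist (V i) (side_line A j) = signed_dist A j (V i)"
  using infdist_side_line[of A j "V i"] A_Suc_neq[of j] V_dist_pos[of j i] by simp

lemma V_neq: "V i \<noteq> A j"
  using V_dist_pos[of j i] by auto

lemma periodic_t: "periodic n t"
  by (simp add: periodic_def log_ratio_def signed_dist_shift)

text \<open>The ray at \<open>A (Suc j)\<close> contains both \<open>V j\<close> and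
  \<open>V (Suc j)\<close>, and the weight recursion may be evaluated at either of them.\<close>

lemma weights_Suc:
  assumes "weights n A V p" "j < n"
  shows "p (Suc j) = p j * exp (t j)"
    and "p (Suc j) = p j * (signed_dist A j (V j) / signed_dist A (Suc j) (V j))"
proof -
  obtain l where l: "ray_system A V l"
    and p: "\<And>z. z \<in> l (Suc j) - {A (Suc j)} \<Longrightarrow>
      p (Suc j) = p j * (infdist z (side_line A j) / infdist z (side_line A (Suc j)))"
    using assms unfolding weights_def by fastforce
  have "V (Suc j) \<in> l (Suc j)" "V j \<in> l (Suc j)"
    using l by (auto simp: ray_system_def)
  then show "p (Suc j) = p j * exp (t j)"
    and "p (Suc j) = p j * (signed_dist A j (V j) / signed_dist A (Suc j) (V j))"
    using p[of "V (Suc j)"] p[of "V j"] V_neq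
    by (simp_all add: V_infdist log_ratio_def V_dist_pos)
qed

lemma weights_eq:
  assumes "weights n A V p" "k \<le> n"
  shows "p k = exp (\<Sum>j<k. t j)"
  using assms(2)
proof (induction k)
  case 0
  then show ?case
    using assms(1) by (auto simp: weights_def)
next
  case (Suc k)
  then show ?case
    using weights_Suc(1)[OF assms(1), of k] by (simp add: exp_add)
qed

lemma ex_weights: obtains p where "weights n A V p" "p n = 1"
  using normalized by (auto simp: normalized_system_def)

lemma sum_t: "(\<Sum>j<n. t j) = 0"
proof -
  obtain p where p: "weights n A V p" "p n = 1" by (rule ex_weights)
  then have "exp (\<Sum>j<n. t j) = 1"
    using weights_eq[of p n] by simp
  then show ?thesis by simp
qed

text \<open>Comparing the two formulas for \<open>p (Suc j)\<close> settles \<open>j < n\<close>,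
  where the weights are constrained; periodicity gives the rest.\<close>

lemma log_ratio_previous: "t j = ln (signed_dist A j (V j) / signed_dist A (Suc j) (V j))"
proof -
  have *: "t j = ln (signed_dist A j (V j) / signed_dist A (Suc j) (V j))" if "j < n" for j
  proof -
    obtain p where p: "weights n A V p" by (rule ex_weights)
    have "p j \<noteq> 0"
      using weights_eq[OF p, of j] that by simp
    then have "exp (t j) = signed_dist A j (V j) / signed_dist A (Suc j) (V j)"
      using weights_Suc[OF p that] mult_left_cancel by metis
    then show ?thesis
      by (metis ln_exp)
  qed
  have "periodic n (\<lambda>j. t j = ln (signed_dist A j (V j) / signed_dist A (Suc j) (V j)))"
    using periodic_t by (simp add: periodic_def signed_dist_shift)
  from periodic_cong[OF this, of j "j mod n"] show ?thesis
    using *[of "j mod n"] n_pos by simp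
qed

lemma V_eq_apex: "V (Suc j) = apex A j (t j) (t (Suc j))"
  and cot_sum_pos: "0 < cot_sum A j (t j) (t (Suc j))"
  using apex_unique[OF V_dist_pos V_dist_pos V_dist_pos log_ratio_def[of A V j] log_ratio_previous[of "Suc j"]] by auto

lemma ratio_const: "\<exists>c. \<forall>j. angle_area_ratio A j (t j) (t (Suc j)) = c"
proof -
  obtain c where c: "\<And>i. vertex_angle (A i) (V i) (A (Suc i)) / measure lebesgue (tri A V i) = c"
    using normalized by (auto simp: normalized_system_def proportional_def)
  have "2 * angle_area_ratio A j (t j) (t (Suc j)) = c" for j
    using apex_ratio[OF cot_sum_pos[of j]] c[of "Suc j"] by (simp add: tri_def V_eq_apex)
  then have "\<forall>j. angle_area_ratio A j (t j) (t (Suc j)) = c / 2"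
    by (simp add: field_simps)
  then show ?thesis ..
qed

text \<open>Since the log ratios have sum zero over a period, their partial sums are
  periodic.\<close>

lemma weighted_ngon_exp_sum: "weighted_ngon n A (\<lambda>k. exp (\<Sum>j<k. t j))"
  by unfold_locales (auto simp: periodic_def sum_lessThan_period[OF periodic_t sum_t])

lemma cells:
  assumes p: "weights n A V p" and i: "i \<in> {1..n}"
  shows "convex_polygon (cell n A p i)" "cell n A p i \<subseteq> tri A V i"
    "closed_segment (A i) (A (Suc i)) \<subseteq> cell n A p i"
    "j \<in> {1..n} \<Longrightarrow> i \<noteq> j \<Longrightarrow> interior (cell n A p i) \<inter> interior (cell n A p j) = {}"
    "(\<Union>i\<in>{1..n}. cell n A p i) = polygon_of n A"
proof -
  define q where "q k = exp (\<Sum>j<k. t j)" for k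
  interpret w: weighted_ngon n A q
    unfolding q_def by (rule weighted_ngon_exp_sum)
  have eq: "cell n A p i = weighted_cell n A q i" if "i \<in> {1..n}" for i
    using weights_eq[OF p] that by (intro w.cell_eq_weighted_cell) (auto simp: q_def)
  show "convex_polygon (cell n A p i)"
    using w.weighted_cell_polytope w.weighted_cell_interior by (simp add: convex_polygon_def eq[OF i])
  show "closed_segment (A i) (A (Suc i)) \<subseteq> cell n A p i"
    unfolding eq[OF i] by (rule w.base_in_weighted_cell)
  show "(\<Union>i\<in>{1..n}. cell n A p i) = polygon_of n A"
    using w.weighted_cells_cover by (simp add: eq)
  show "interior (cell n A p i) \<inter> interior (cell n A p j) = {}" if j: "j \<in> {1..n}" "i \<noteq> j"
  proof -
    have "A i \<noteq> A j"
      using convex_ngon i j by (auto simp: convex_ngon_def dest: inj_onD)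
    then show ?thesis
      unfolding eq[OF i] eq[OF j(1)] by (intro w.weighted_cells_interiors) (simp add: A_eq_iff)
  qed
  obtain k where k: "i = Suc k"
    using i by (cases i) auto
  \<comment> \<open>As \<open>q (Suc k) = q k * exp (t k)\<close>, the two equations say that
    \<open>V (Suc k)\<close> has equal weighted distances from side lines \<open>k\<close>,
    \<open>Suc k\<close> and \<open>Suc (Suc k)\<close>.\<close>
  have "exp (t k) * signed_dist A (Suc k) (V (Suc k)) = signed_dist A k (V (Suc k))"
    using V_dist_pos[of k "Suc k"] V_dist_pos[of "Suc k" "Suc k"] by (simp add: log_ratio_def)
  moreover have "exp (t (Suc k)) * signed_dist A (Suc (Suc k)) (V (Suc k)) = signed_dist A (Suc k) (V (Suc k))"
    using V_dist_pos[of "Suc k" "Suc k"] V_dist_pos[of "Suc (Suc k)" "Suc k"]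
    by (simp add: log_ratio_previous)
  ultimately have "weighted_cell n A q (Suc k) \<subseteq> convex hull {A (Suc k), A (Suc (Suc k)), V (Suc k)}"
    by (intro w.weighted_cell_in_tri[OF V_dist_pos]) (auto simp: q_def exp_add)
  then show "cell n A p i \<subseteq> tri A V i"
    unfolding eq[OF i] by (simp add: k tri_def)
qed

end

text \<open>\<open>rigid\<close> is checked directly on the data of the two systems: strict
  monotonicity of the ratio is available where \<open>cot_sum\<close> is positive, and
  \<open>cot_sum_pos\<close> provides this at every apex.\<close>

lemma (in deep_ngon) normalized_system_unique:
  assumes "normalized_system n \<rho> A V" "normalized_system n \<rho> A W"
  shows "V = W"
proof -
  interpret v: normalized_ngon n A \<rho> V by unfold_locales fact
  interpret w: normalized_ngon n A \<rho> W by unfold_locales fact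
  obtain c where c: "\<And>j. angle_area_ratio A j (v.t j) (v.t (Suc j)) = c" using v.ratio_const by blast
  obtain d where d: "\<And>j. angle_area_ratio A j (w.t j) (w.t (Suc j)) = d" using w.ratio_const by blast
  have rigid: "t j = u j \<and> t (Suc j) = u (Suc j)"
    if "angle_area_ratio A j (t j) (t (Suc j)) \<le> angle_area_ratio A j (u j) (u (Suc j))"
      "0 < cot_sum A j (u j) (u (Suc j))" "u j \<le> t j" "t (Suc j) \<le> u (Suc j)" for t u j
    using that angle_area_ratio_strict_mono[OF turn_pos turn_pos A_Suc_neq, of j "u j" "u (Suc j)" "t j" "t (Suc j)"]
    by force
  have "v.t = w.t"
  proof (cases "c \<le> d")
    case True
    show ?thesis
      by (rule cyclic_unique[OF n_pos v.periodic_t w.periodic_t])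
        (use True c d rigid w.cot_sum_pos v.sum_t w.sum_t in auto)
  next
    case False
    have "w.t = v.t"
      by (rule cyclic_unique[OF n_pos w.periodic_t v.periodic_t])
        (use False c d rigid v.cot_sum_pos v.sum_t w.sum_t in auto)
    then show ?thesis ..
  qed
  then have "V (Suc j) = W (Suc j)" for j
    by (simp add: v.V_eq_apex w.V_eq_apex)
  then have "V (i + n) = W (i + n)" for i
    using n_pos by (cases "i + n") auto
  then show ?thesis
    by (simp add: fun_eq_iff)
qed

section \<open>From a solution to a normalized system\<close>

context ngon
begin

lemma ray_dir_distances:
  "signed_dist A j (A (Suc j) + \<tau> *\<^sub>R ray_dir A j x) = \<tau> * exp x"
  "signed_dist A (Suc j) (A (Suc j) + \<tau> *\<^sub>R ray_dir A j x) = \<tau>"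
proof -
  have eq: "A (Suc j) + \<tau> *\<^sub>R ray_dir A j x =
      A (Suc j) + edge_dir A (Suc j) * Complex (ray_cot (turn A j) x * \<tau>) \<tau>"
    by (simp add: ray_dir_def complex_eq_iff algebra_simps)
  note d = signed_dist_frame[OF eq]
  show "signed_dist A j (A (Suc j) + \<tau> *\<^sub>R ray_dir A j x) = \<tau> * exp x"
    unfolding d(2) exp_eq_ray_cot[of x j] by (simp add: algebra_simps)
  show "signed_dist A (Suc j) (A (Suc j) + \<tau> *\<^sub>R ray_dir A j x) = \<tau>"
    by (fact d(1))
qed

lemma apex_on_first_ray:
  "apex A j x y = A (Suc j) + (norm (A (Suc (Suc j)) - A (Suc j)) / cot_sum A j x y) *\<^sub>R ray_dir A j x"
  by (simp add: apex_def ray_dir_def complex_eq_iff algebra_simps)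

text \<open>The parameter on this ray is the distance from side line \<open>Suc (Suc j)\<close>,
  which for the apex is \<open>exp (- y)\<close> times its height.\<close>

lemma apex_on_second_ray:
  assumes "0 < cot_sum A j x y"
  shows "apex A j x y = A (Suc (Suc j)) +
    (norm (A (Suc (Suc j)) - A (Suc j)) / cot_sum A j x y * exp (- y)) *\<^sub>R ray_dir A (Suc j) y"
proof -
  let ?b = "norm (A (Suc (Suc j)) - A (Suc j))" and ?w = "turn A (Suc j)"
  define Y where "Y = ?b / cot_sum A j x y"
  define C where "C = ray_cot ?w (- y)"
  have b: "?b = (ray_cot (turn A j) x + C) * Y"
    using assms by (simp add: Y_def C_def cot_sum_def)
  \<comment> \<open>Rotation by the turn expresses the next frame in the present one, where the ray
    has direction \<open>Complex (- C) 1\<close> stretched by \<open>exp y\<close>.\<close>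
  have "?w * Complex (ray_cot ?w y) 1 = of_real (exp y) * Complex (- C) 1"
  proof (rule complex_eqI)
    have "Re ?w * (exp y - Re ?w) - Im ?w * Im ?w = exp y * (Re ?w - exp (- y))"
      using turn_squares[of "Suc j"] by (simp add: algebra_simps power2_eq_square exp_minus)
    then show "Re (?w * Complex (ray_cot ?w y) 1) = Re (of_real (exp y) * Complex (- C) 1)"
      using turn_pos[of "Suc j"] by (simp add: C_def ray_cot_def field_simps)
    show "Im (?w * Complex (ray_cot ?w y) 1) = Im (of_real (exp y) * Complex (- C) 1)"
      using exp_eq_ray_cot[of y "Suc j"] by simp
  qed
  then have "ray_dir A (Suc j) y = of_real (exp y) * (edge_dir A (Suc j) * Complex (- C) 1)"
    unfolding ray_dir_def edge_dir_Suc[of "Suc j"] by (simp add: mult_ac)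
  then have "(Y * exp (- y)) *\<^sub>R ray_dir A (Suc j) y =
      of_real (Y * (exp (- y) * exp y)) * (edge_dir A (Suc j) * Complex (- C) 1)"
    by (simp add: scaleR_conv_of_real)
  also have "\<dots> = edge_dir A (Suc j) * Complex (- C * Y) Y"
    by (simp add: complex_eq_iff exp_minus algebra_simps)
  also have "\<dots> = edge_dir A (Suc j) * Complex (ray_cot (turn A j) x * Y) Y
      - of_real ?b * edge_dir A (Suc j)"
    unfolding b by (simp add: complex_eq_iff algebra_simps)
  finally have diff: "(Y * exp (- y)) *\<^sub>R ray_dir A (Suc j) y =
      edge_dir A (Suc j) * Complex (ray_cot (turn A j) x * Y) Y - of_real ?b * edge_dir A (Suc j)" .
  have "p + z = p' + z'" if "z' = z - w" "p' = p + w" for p p' z z' w :: complex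
    using that by simp
  from this[OF diff edge_step] show ?thesis
    unfolding Y_def[symmetric] apex_def .
qed

lemma ray_dir_neq_0: "ray_dir A j x \<noteq> 0"
proof -
  have "edge_dir A (Suc j) \<noteq> 0" "Complex (ray_cot (turn A j) x) 1 \<noteq> 0"
    using norm_edge_dir[of "Suc j"] by (auto simp: Complex_eq_0)
  then show ?thesis
    unfolding ray_dir_def by simp
qed

end

lemma closed_segment_subset_ray:
  assumes "0 \<le> \<sigma>"
  shows "closed_segment P (P + \<sigma> *\<^sub>R u) \<subseteq> {P + \<tau> *\<^sub>R u | \<tau>. 0 \<le> \<tau>}"
proof
  fix z assume "z \<in> closed_segment P (P + \<sigma> *\<^sub>R u)"
  then obtain v where "0 \<le> v" "z = (1 - v) *\<^sub>R P + v *\<^sub>R (P + \<sigma> *\<^sub>R u)"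
    by (auto simp: closed_segment_def)
  then have "z = P + (v * \<sigma>) *\<^sub>R u" "0 \<le> v * \<sigma>"
    using assms by (auto simp: algebra_simps)
  then show "z \<in> {P + \<tau> *\<^sub>R u | \<tau>. 0 \<le> \<tau>}"
    by blast
qed

lemma closed_segment_on_ray:
  fixes P u :: "'a :: real_vector"
  assumes "0 \<le> \<sigma>" "\<sigma> \<le> \<tau>"
  shows "closed_segment P (P + \<sigma> *\<^sub>R u) \<subseteq> closed_segment P (P + \<tau> *\<^sub>R u)"
proof (rule subset_closed_segment[THEN iffD2])
  have "P + \<sigma> *\<^sub>R u \<in> closed_segment P (P + \<tau> *\<^sub>R u)"
  proof (cases "\<tau> = 0")
    case True
    with assms show ?thesis by simp
  next
    case False
    have "P + \<sigma> *\<^sub>R u = (1 - \<sigma> / \<tau>) *\<^sub>R P + (\<sigma> / \<tau>) *\<^sub>R (P + \<tau> *\<^sub>R u)"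
      using False by (simp add: algebra_simps)
    moreover have "0 \<le> \<sigma> / \<tau>" "\<sigma> / \<tau> \<le> 1"
      using assms False by (auto simp: divide_le_eq_1)
    ultimately show ?thesis
      unfolding closed_segment_def by blast
  qed
  then show "P \<in> closed_segment P (P + \<tau> *\<^sub>R u) \<and> P + \<sigma> *\<^sub>R u \<in> closed_segment P (P + \<tau> *\<^sub>R u)"
    by simp
qed

text \<open>Consecutive apices lie on a common ray from the vertex between them, which gives the
  shared sides. The weights are exponentials of partial sums of \<open>t\<close>, so sum zero means
  \<open>p n = 1\<close>.\<close>

lemma (in ngon) normalized_system_of_solution:
  assumes t: "periodic n t" "(\<Sum>j<n. t j) = 0"
    and cot: "\<And>j. 0 < cot_sum A j (t j) (t (Suc j))"
    and ratio: "\<And>j. angle_area_ratio A j (t j) (t (Suc j)) = c"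
    and V: "periodic n V" "\<And>j. V (Suc j) = apex A j (t j) (t (Suc j))"
    and small: "\<And>i. norm (V i) < \<rho>"
  shows "normalized_system n \<rho> A V"
proof -
  have V_shift: "V (i + n) = V i" "V (Suc (i + n)) = V (Suc i)" for i
    using V(1) by (auto simp: periodic_def simp flip: add_Suc)
  have A_shift2: "A (Suc (Suc (i + n))) = A (Suc (Suc i))" for i
    using A_shift(1)[of "Suc (Suc i)"] by simp
  \<comment> \<open>The apices are given at successor indices; periodicity transfers statements
    about them to index \<open>0\<close>.\<close>
  have all: "P i" if step: "\<And>j. P (Suc j)" and per: "\<And>i. P (i + n) = P i" for P :: "nat \<Rightarrow> bool" and i
    using step[of "i + n - 1"] per[of i] n_pos by simp
  define Y where "Y j = norm (A (Suc (Suc j)) - A (Suc j)) / cot_sum A j (t j) (t (Suc j))" for j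
  have Y: "0 < Y j" for j
    using apex_distances(1)[OF cot] by (simp add: Y_def)
  have first: "V (Suc j) = A (Suc j) + Y j *\<^sub>R ray_dir A j (t j)" for j
    unfolding V(2) Y_def by (rule apex_on_first_ray)
  have second: "V (Suc j) = A (Suc (Suc j)) + (Y j * exp (- t (Suc j))) *\<^sub>R ray_dir A (Suc j) (t (Suc j))" for j
    unfolding V(2) Y_def by (rule apex_on_second_ray[OF cot])
  have tri_shift: "tri A V (i + n) = tri A V i" "tri A V (Suc (i + n)) = tri A V (Suc i)" for i
    by (simp_all add: tri_def V_shift A_shift2)

  have noncollinear: "\<not> collinear {A i, A (Suc i), V i}" for i
  proof (rule all[of "\<lambda>i. \<not> collinear {A i, A (Suc i), V i}"])
    fix j
    show "\<not> collinear {A (Suc j), A (Suc (Suc j)), V (Suc j)}"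
      using apex_distances(1,2)[OF cot[of j]] unfolding V(2) collinear_iff_cross signed_dist_eq by auto
  qed (simp add: V_shift)

  have meets: "tri A V i \<inter> polygon_of n A \<noteq> {}" for i
    using A_in_polygon[of i] hull_subset[of "{A i, A (Suc i), V i}" convex] by (auto simp: tri_def)

  have shared: "\<exists>S \<in> tri_sides (A i) (A (Suc i)) (V i) \<union> tri_sides (A (Suc i)) (A (Suc (Suc i))) (V (Suc i)).
      S \<subseteq> frontier (tri A V i) \<inter> frontier (tri A V (Suc i))" (is "?S i") for i
  proof (rule all[of ?S])
    fix j
    let ?P = "A (Suc (Suc j))" and ?u = "ray_dir A (Suc j) (t (Suc j))"
    have frontier: "frontier (tri A V i) = closed_segment (A i) (A (Suc i)) \<union>
        closed_segment (A (Suc i)) (V i) \<union> closed_segment (V i) (A i)" for i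
      unfolding tri_def by (rule frontier_of_triangle) simp
    let ?s = "Y j * exp (- t (Suc j))" and ?r = "Y (Suc j)"
    have segs: "closed_segment ?P (V (Suc j)) = closed_segment ?P (?P + ?s *\<^sub>R ?u)"
      "closed_segment ?P (V (Suc (Suc j))) = closed_segment ?P (?P + ?r *\<^sub>R ?u)"
      using second[of j] first[of "Suc j"] by simp_all
    \<comment> \<open>The shorter of the two segments on the common ray is an entire side of its
      triangle and lies in a side of the other.\<close>
    show "?S (Suc j)"
    proof (cases "?s \<le> ?r")
      case True
      then have "closed_segment ?P (V (Suc j)) \<subseteq> closed_segment ?P (V (Suc (Suc j)))"
        unfolding segs using Y[of j] by (intro closed_segment_on_ray) auto
      then show ?thesis
        by (intro bexI[of _ "closed_segment ?P (V (Suc j))"])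
          (auto simp: frontier tri_sides_def closed_segment_commute)
    next
      case False
      then have "closed_segment ?P (V (Suc (Suc j))) \<subseteq> closed_segment ?P (V (Suc j))"
        unfolding segs using Y[of "Suc j"] by (intro closed_segment_on_ray) auto
      then show ?thesis
        by (intro bexI[of _ "closed_segment ?P (V (Suc (Suc j)))"])
          (auto simp: frontier tri_sides_def closed_segment_commute)
    qed
  qed (simp add: V_shift A_shift2 tri_shift)

  have "proportional A V"
    unfolding proportional_def
  proof (intro exI allI)
    fix i
    let ?Q = "\<lambda>i. vertex_angle (A i) (V i) (A (Suc i)) / measure lebesgue (tri A V i) = 2 * c"
    show "?Q i"
    proof (rule all[of ?Q])
      show "?Q (Suc j)" for j
        using apex_ratio[OF cot[of j]] unfolding tri_def V(2) ratio .
    qed (simp add: V_shift tri_shift)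
  qed

  moreover have "weights n A V (\<lambda>k. exp (\<Sum>j<k. t j))"
    unfolding weights_def
  proof (intro exI conjI ballI)
    \<comment> \<open>\<open>i + n - 1\<close> is the predecessor of \<open>i\<close> modulo
      \<open>n\<close>; adding \<open>n\<close> avoids truncated subtraction at
      \<open>0\<close>.\<close>
    define l where "l i = {A i + \<tau> *\<^sub>R ray_dir A (i + n - 1) (t (i + n - 1)) | \<tau>. 0 \<le> \<tau>}" for i
    have "l (Suc j) = {A (Suc j) + \<tau> *\<^sub>R ray_dir A j (t j) | \<tau>. 0 \<le> \<tau>}" for j
      using t(1) A_shift2[of j]
      by (simp add: l_def ray_dir_def edge_dir_def turn_def periodic_def)
    note l = this
    have l_shift: "l (i + n) = l i" "l (Suc (i + n)) = l (Suc i)" for i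
    proof -
      have *: "l (j + n) = l j" for j
      proof -
        obtain k where k: "j + n = Suc k"
          using n_pos by (cases "j + n") auto
        show ?thesis
          unfolding k l unfolding l_def k[symmetric] by (simp add: k A_shift(1)[of j, unfolded k])
      qed
      show "l (i + n) = l i" "l (Suc (i + n)) = l (Suc i)"
        using *[of i] *[of "Suc i"] by simp_all
    qed
    show "ray_system A V l"
      unfolding ray_system_def
    proof
      fix i
      let ?R = "\<lambda>i. is_ray (A i) (l i) \<and> closed_segment (A i) (V i) \<subseteq> l i \<and>
        closed_segment (A (Suc i)) (V i) \<subseteq> l (Suc i)"
      show "?R i"
      proof (rule all[of ?R])
        fix j
        show "?R (Suc j)"
        proof (intro conjI)
          show "is_ray (A (Suc j)) (l (Suc j))"
            unfolding is_ray_def l using ray_dir_neq_0 by blast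
          show "closed_segment (A (Suc j)) (V (Suc j)) \<subseteq> l (Suc j)"
            unfolding l first[of j] using Y[of j] by (intro closed_segment_subset_ray) simp
          show "closed_segment (A (Suc (Suc j))) (V (Suc j)) \<subseteq> l (Suc (Suc j))"
            unfolding l second[of j] using Y[of j] by (intro closed_segment_subset_ray) simp
        qed
      qed (simp add: l_shift V_shift)
    qed
    fix i z
    assume "i \<in> {1..n}" and z: "z \<in> l i - {A i}"
    then obtain j where i: "i = Suc j"
      by (cases i) auto
    obtain \<tau> where \<tau>: "0 < \<tau>" and z_eq: "z = A (Suc j) + \<tau> *\<^sub>R ray_dir A j (t j)"
      using z unfolding i l by (force simp: less_le)
    have "infdist z (side_line A j) / infdist z (side_line A (Suc j)) = exp (t j)"
      unfolding infdist_side_line[of A, OF A_Suc_neq] z_eq ray_dir_distances using \<tau> by (simp add: abs_mult)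
    then show "exp (\<Sum>j<i. t j) =
        exp (\<Sum>j<i - 1. t j) * (infdist z (side_line A (i - 1)) / infdist z (side_line A i))"
      unfolding i by (simp add: exp_add)
  qed simp
  moreover have "admissible n A V"
    unfolding admissible_def using V(1) noncollinear meets shared by blast
  ultimately show ?thesis
    unfolding normalized_system_def using small t(2) by auto
qed

section \<open>Perturbation of the regular polygon\<close>

definition clamp_real :: "real \<Rightarrow> real \<Rightarrow> real" where
  "clamp_real r x = max (- r) (min r x)"

text \<open>Agrees with \<open>G\<close> for arguments in \<open>[- r, r]\<close>; the linear terms keep it strictly monotone and
  make it unbounded.\<close>

definition clamped :: "real \<Rightarrow> (nat \<Rightarrow> real \<Rightarrow> real \<Rightarrow> real) \<Rightarrow> nat \<Rightarrow> real \<Rightarrow> real \<Rightarrow> real" where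
  "clamped r G j x y =
     G j (clamp_real r x) (clamp_real r y) + (x - clamp_real r x) - (y - clamp_real r y)"

lemma clamp_real_mem: "0 \<le> r \<Longrightarrow> \<bar>clamp_real r x\<bar> \<le> r"
  by (auto simp: clamp_real_def)

lemma clamp_real_id: "\<bar>x\<bar> \<le> r \<Longrightarrow> clamp_real r x = x"
  by (auto simp: clamp_real_def)

lemma clamp_real_mono:
  "0 \<le> r \<Longrightarrow> x \<le> y \<Longrightarrow> clamp_real r x \<le> clamp_real r y \<and> x - clamp_real r x \<le> y - clamp_real r y"
  by (auto simp: clamp_real_def min_def max_def)

text \<open>If neither clamped argument moves, strictness comes from the linear terms, otherwise
  from \<open>G\<close> on the square.\<close>

lemma cyclic_system_clamped:
  assumes "0 < n" "0 \<le> r" "periodic n G"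
    and mono: "\<And>j x x' y y'. \<bar>x\<bar> \<le> r \<Longrightarrow> \<bar>x'\<bar> \<le> r \<Longrightarrow> \<bar>y\<bar> \<le> r \<Longrightarrow> \<bar>y'\<bar> \<le> r \<Longrightarrow>
      x \<le> x' \<Longrightarrow> y' \<le> y \<Longrightarrow> x < x' \<or> y' < y \<Longrightarrow> G j x y < G j x' y'"
    and cont: "\<And>j y. continuous_on UNIV (\<lambda>x. G j x y)" "\<And>j x. continuous_on UNIV (\<lambda>y. G j x y)"
  shows "cyclic_system n (clamped r G)"
proof
  let ?c = "clamp_real r"
  show "0 < n" by fact
  show "periodic n (clamped r G)"
    using assms(3) by (simp add: periodic_def clamped_def fun_eq_iff)
  show "clamped r G j x y < clamped r G j x' y'" if xy: "x \<le> x'" "y' \<le> y" "x < x' \<or> y' < y" for j x x' y y'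
  proof -
    note c = clamp_real_mono[OF \<open>0 \<le> r\<close> xy(1)] clamp_real_mono[OF \<open>0 \<le> r\<close> xy(2)]
    show ?thesis
    proof (cases "?c x < ?c x' \<or> ?c y' < ?c y")
      case True
      then have "G j (?c x) (?c y) < G j (?c x') (?c y')"
        using c clamp_real_mem[OF \<open>0 \<le> r\<close>] by (intro mono) auto
      then show ?thesis
        using c by (simp add: clamped_def)
    next
      case False
      then have "?c x = ?c x'" "?c y = ?c y'"
        using c by auto
      then show ?thesis
        using xy by (auto simp: clamped_def)
    qed
  qed
  have clamp_cont: "continuous_on UNIV ?c"
    unfolding clamp_real_def by (intro continuous_intros)
  show "continuous_on UNIV (\<lambda>x. clamped r G j x y)" for j y
    unfolding clamped_def
    by (intro continuous_intros clamp_cont continuous_on_compose2[OF cont(1) clamp_cont]) auto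
  show "continuous_on UNIV (\<lambda>y. clamped r G j x y)" for j x
    unfolding clamped_def
    by (intro continuous_intros clamp_cont continuous_on_compose2[OF cont(2) clamp_cont]) auto
  fix j c x
  \<comment> \<open>Moving \<open>y\<close> by \<open>h\<close> below \<open>- r\<close> adds
    \<open>h\<close> to \<open>?lo\<close>; moving it by \<open>h\<close> above \<open>r\<close>
    subtracts \<open>h\<close> from \<open>?hi\<close>. Taking the gap to \<open>c\<close> as
    \<open>h\<close> reaches the level.\<close>
  let ?lo = "G j (?c x) (- r) + (x - ?c x)" and ?hi = "G j (?c x) r + (x - ?c x)"
  show "\<exists>y. c \<le> clamped r G j x y"
    by (rule exI[of _ "- r - \<bar>c - ?lo\<bar>"]) (use \<open>0 \<le> r\<close> in \<open>simp add: clamped_def clamp_real_def\<close>)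
  show "\<exists>y. clamped r G j x y \<le> c"
    by (rule exI[of _ "r + \<bar>?hi - c\<bar>"]) (use \<open>0 \<le> r\<close> in \<open>simp add: clamped_def clamp_real_def\<close>)
qed

lemma continuous_angle_area_ratio:
  assumes "0 < Im (turn A j)" "0 < Im (turn A (Suc j))" "A (Suc (Suc j)) \<noteq> A (Suc j)"
  shows "continuous_on UNIV (\<lambda>x. angle_area_ratio A j x y)" "continuous_on UNIV (angle_area_ratio A j x)"
  unfolding angle_area_ratio_def cot_sum_def ray_cot_def
  by (intro continuous_intros; use assms in simp)+

text \<open>On the square the cotangent sum is smallest at the corner \<open>(- r, r)\<close>, so
  positivity there gives monotonicity throughout.\<close>

lemma cyclic_system_angle_area_ratio:
  assumes "0 < n" "0 \<le> r" "periodic n (angle_area_ratio A)"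
    and turn: "\<And>j. 0 < Im (turn A j)" and side: "\<And>j. A (Suc j) \<noteq> A j"
    and corner: "\<And>j. 0 < cot_sum A j (- r) r"
  shows "cyclic_system n (clamped r (angle_area_ratio A))"
proof (rule cyclic_system_clamped[OF assms(1-3)])
  fix j and x x' y y' :: real
  assume "\<bar>x\<bar> \<le> r" "\<bar>y\<bar> \<le> r" and xy: "x \<le> x'" "y' \<le> y" "x < x' \<or> y' < y"
  then have "cot_sum A j (- r) r \<le> cot_sum A j x y"
    unfolding cot_sum_def using turn by (intro add_mono ray_cot_mono) auto
  then show "angle_area_ratio A j x y < angle_area_ratio A j x' y'"
    using corner[of j] by (intro angle_area_ratio_strict_mono turn side xy) simp
qed (use turn side in \<open>auto intro: continuous_angle_area_ratio\<close>)

section \<open>Limits along polygons near the regular one\<close>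

definition near_regular :: "nat \<Rightarrow> (nat \<Rightarrow> complex) filter" where
  "near_regular n = inf (filtercomap (\<lambda>A. tuple_dist n A (regular_vertex n)) (nhds 0))
     (principal {A. convex_ngon n A})"

text \<open>Translates between eventual statements and the \<delta>-form of the theorem. Distance
  zero is included, so the regular polygon itself is covered.\<close>

lemma eventually_near_regular:
  "eventually P (near_regular n) \<longleftrightarrow>
     (\<exists>\<delta>>0. \<forall>A. convex_ngon n A \<and> tuple_dist n A (regular_vertex n) < \<delta> \<longrightarrow> P A)" (is "_ \<longleftrightarrow> ?R")
proof
  have nonneg: "0 \<le> tuple_dist n A B" for A B
    by (simp add: tuple_dist_def L2_set_nonneg)
  have ev: "eventually P (near_regular n) \<longleftrightarrow> (\<exists>Q. eventually Q (nhds 0) \<and>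
      (\<forall>A. Q (tuple_dist n A (regular_vertex n)) \<longrightarrow> convex_ngon n A \<longrightarrow> P A))"
    by (simp add: near_regular_def eventually_inf_principal eventually_filtercomap)
  show ?R if "eventually P (near_regular n)"
  proof -
    from that ev obtain Q where "eventually Q (nhds 0)"
      and Q: "\<And>A. Q (tuple_dist n A (regular_vertex n)) \<Longrightarrow> convex_ngon n A \<Longrightarrow> P A"
      by blast
    then obtain \<delta> where "0 < \<delta>" "\<And>x :: real. dist x 0 < \<delta> \<Longrightarrow> Q x"
      by (auto simp: eventually_nhds_metric)
    then show ?thesis
      using Q nonneg by (intro exI[of _ \<delta>]) auto
  qed
  show "eventually P (near_regular n)" if ?R
  proof -
    from that obtain \<delta> where "0 < \<delta>"
      "\<And>A. convex_ngon n A \<and> tuple_dist n A (regular_vertex n) < \<delta> \<Longrightarrow> P A"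
      by blast
    moreover have "eventually (\<lambda>x :: real. x < \<delta>) (nhds 0)"
      unfolding eventually_nhds_metric using \<open>0 < \<delta>\<close>
      by (intro exI[of _ \<delta>]) (auto simp: dist_real_def)
    ultimately show ?thesis
      unfolding ev by blast
  qed
qed

lemma eventually_ngon: "eventually (ngon n) (near_regular n)"
  unfolding eventually_near_regular by (intro exI[of _ 1]) (auto intro: ngon.intro)

section \<open>The regular polygon\<close>

locale regular_limit =
  fixes n :: nat
  assumes n_ge_3: "3 \<le> n"
begin

abbreviation "F \<equiv> near_regular n"
abbreviation "R \<equiv> regular_vertex n"

definition "\<tau> = 2 * pi / real n"

lemma tau: "0 < \<tau>" "\<tau> < pi" and sin_pos: "0 < sin \<tau>" and cos_less_1: "cos \<tau> < 1" and cos_gt: "- 1 < cos \<tau>"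
proof -
  show \<tau>: "0 < \<tau>" "\<tau> < pi"
    using n_ge_3 by (auto simp: \<tau>_def field_simps)
  then show s: "0 < sin \<tau>"
    by (rule sin_gt_zero)
  have "cos \<tau> \<noteq> 1" "cos \<tau> \<noteq> - 1"
    using s sin_squared_eq[of \<tau>] by auto
  then show "cos \<tau> < 1" "- 1 < cos \<tau>"
    using cos_le_one[of \<tau>] cos_ge_minus_one[of \<tau>] by linarith+
qed

lemma R_eq: "R i = cis (real i * \<tau>)"
  by (simp add: regular_vertex_def \<tau>_def complex_eq_iff mult.commute)

lemma cis_tau_neq_1: "cis \<tau> - 1 \<noteq> 0"
  using cos_less_1 by (simp add: complex_eq_iff)

lemma R_edge: "R (Suc j) - R j = cis (real j * \<tau>) * (cis \<tau> - 1)"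
  by (simp add: R_eq cis_mult algebra_simps)

lemma R_Suc_neq: "R (Suc j) \<noteq> R j"
  using R_edge[of j] cis_tau_neq_1 by auto

lemma R_length: "norm (R (Suc j) - R j) = norm (cis \<tau> - 1)"
  by (simp add: R_edge norm_mult)

lemma R_edge_dir: "edge_dir R j = cis (real j * \<tau>) * sgn (cis \<tau> - 1)"
  by (simp add: edge_dir_def R_edge sgn_mult)

lemma R_turn: "turn R j = cis \<tau>"
proof -
  let ?s = "sgn (cis \<tau> - 1)"
  have "norm ?s = 1"
    using cis_tau_neq_1 by (simp add: norm_sgn)
  then have s: "cnj ?s * ?s = 1"
    using complex_norm_square[of ?s] by (simp add: mult.commute)
  have "turn R j = cnj (cis (real j * \<tau>)) * cis (real (Suc j) * \<tau>) * (cnj ?s * ?s)"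
    by (simp only: turn_def R_edge_dir complex_cnj_mult mult_ac)
  also have "\<dots> = cis \<tau>"
    unfolding s by (simp add: cis_cnj cis_mult algebra_simps)
  finally show ?thesis .
qed

lemma R_cot_sum: "cot_sum R j x y = ((exp x - cos \<tau>) + (exp (- y) - cos \<tau>)) / sin \<tau>"
  by (simp add: cot_sum_def ray_cot_def R_turn add_divide_distrib diff_divide_distrib)

lemma R_angle_area_ratio: "angle_area_ratio R j = angle_area_ratio R 0"
  unfolding angle_area_ratio_def R_cot_sum R_turn R_length by (rule refl)

text \<open>The value is the apothem \<open>cos (\<tau> / 2)\<close>.\<close>

lemma R_signed_dist_0: "signed_dist R j 0 = sin \<tau> / norm (cis \<tau> - 1)"
proof -
  have "cnj (edge_dir R j) * (0 - R j) =
      - (cnj (cis (real j * \<tau>)) * cis (real j * \<tau>) * cnj (sgn (cis \<tau> - 1)))"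
    by (simp only: R_edge_dir R_eq complex_cnj_mult) (simp add: mult_ac)
  also have "\<dots> = - cnj (sgn (cis \<tau> - 1))"
    by (simp add: cis_cnj cis_mult)
  finally show ?thesis
    by (simp add: signed_dist_def sgn_eq)
qed

text \<open>Log ratio \<open>0\<close> gives angle bisectors, which meet at the center. In the frame
  of a side of length \<open>?b\<close> the center has abscissa \<open>?b / 2\<close> and height
  \<open>?b / (2 * ?B)\<close>, where \<open>?B\<close> is the tangent of half of
  \<open>\<tau>\<close>.\<close>

lemma R_apex: "apex R j 0 0 = 0"
proof -
  let ?b = "norm (cis \<tau> - 1)" and ?B = "(1 - cos \<tau>) / sin \<tau>"
  have B: "?B \<noteq> 0" and s: "sin \<tau> \<noteq> 0"
    using sin_pos cos_less_1 by auto
  have b: "sgn (cis \<tau> - 1) * of_real ?b = cis \<tau> - 1"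
    using cis_tau_neq_1 by (simp add: sgn_eq)
  have 0: "1 + (cis \<tau> - 1) * Complex (1 / 2) (1 / (2 * ?B)) = 0"
  proof (rule complex_eqI)
    have "sin \<tau> * sin \<tau> = 1 - cos \<tau> * cos \<tau>"
      using sin_squared_eq[of \<tau>] by (simp add: power2_eq_square)
    then have "2 * (cos \<tau> * cos \<tau>) + 2 * (sin \<tau> * sin \<tau>) = 2"
      by simp
    then have "sin \<tau> * (1 / (2 * ?B)) = (1 + cos \<tau>) / 2"
      using s cos_less_1 by (simp add: field_simps)
    then show "Re (1 + (cis \<tau> - 1) * Complex (1 / 2) (1 / (2 * ?B))) = Re 0"
      by (simp add: field_simps)
    show "Im (1 + (cis \<tau> - 1) * Complex (1 / 2) (1 / (2 * ?B))) = Im 0"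
      using s cos_less_1 by (simp add: field_simps)
  qed
  have scale: "Complex (B * (b / (2 * B))) (b / (2 * B)) = of_real b * Complex (1 / 2) (1 / (2 * B))"
    if "B \<noteq> 0" for B b :: real
    using that by (simp add: complex_eq_iff)
  have "ray_cot (turn R j) 0 = ?B" "cot_sum R j 0 0 = 2 * ?B"
    by (simp_all add: ray_cot_def R_turn R_cot_sum)
  then have "apex R j 0 0 = R (Suc j) + edge_dir R (Suc j) * Complex (?B * (?b / (2 * ?B))) (?b / (2 * ?B))"
    unfolding apex_def R_length by simp
  also have "Complex (?B * (?b / (2 * ?B))) (?b / (2 * ?B)) = of_real ?b * Complex (1 / 2) (1 / (2 * ?B))"
    by (rule scale[OF B])
  also have "R (Suc j) + edge_dir R (Suc j) * (of_real ?b * Complex (1 / 2) (1 / (2 * ?B))) =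
      cis (real (Suc j) * \<tau>) * (1 + sgn (cis \<tau> - 1) * of_real ?b * Complex (1 / 2) (1 / (2 * ?B)))"
    unfolding R_edge_dir R_eq[of "Suc j"] by (simp only: distrib_left mult_1_right mult.assoc)
  also have "\<dots> = 0"
    unfolding b 0 by simp
  finally show ?thesis .
qed

lemma R_mod: "i mod n = k mod n \<Longrightarrow> R i = R k"
proof (rule periodic_cong)
  show "periodic n R"
    unfolding periodic_def
  proof
    fix i
    have "real (i + n) * \<tau> = real i * \<tau> + 2 * pi"
      using n_ge_3 by (simp add: \<tau>_def field_simps)
    then show "R (i + n) = R i"
      by (simp add: R_eq cis_mult[symmetric])
  qed
qed

section \<open>Convergence of the geometric quantities\<close>

lemma tendsto_vertex: "((\<lambda>A. A i) \<longlongrightarrow> R i) F"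
proof (rule tendstoI)
  fix \<epsilon> :: real assume "0 < \<epsilon>"
  have "dist (A i) (R i) < \<epsilon>" if "convex_ngon n A" "tuple_dist n A R < \<epsilon>" for A
  proof -
    interpret ngon n A by (rule ngon.intro) fact
    obtain k where k: "k \<in> {1..n}" "A k = A i" "k mod n = i mod n" by (rule ex_index)
    have "dist (A k) (R k) \<le> tuple_dist n A R"
      unfolding tuple_dist_def using k(1) by (intro member_le_L2_set) auto
    then show ?thesis
      using that k R_mod[of k i] by simp
  qed
  then show "eventually (\<lambda>A. dist (A i) (R i) < \<epsilon>) F"
    unfolding eventually_near_regular using \<open>0 < \<epsilon>\<close> by blast
qed

lemma tendsto_edge_dir: "((\<lambda>A. edge_dir A j) \<longlongrightarrow> edge_dir R j) F"
  unfolding edge_dir_def using R_Suc_neq[of j] by (intro tendsto_sgn tendsto_diff tendsto_vertex) simp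

lemma tendsto_turn: "((\<lambda>A. turn A j) \<longlongrightarrow> turn R j) F"
  unfolding turn_def by (intro tendsto_intros tendsto_edge_dir)

lemma tendsto_length: "((\<lambda>A. norm (A (Suc j) - A j)) \<longlongrightarrow> norm (R (Suc j) - R j)) F"
  by (intro tendsto_intros tendsto_vertex)

lemma tendsto_ray_cot:
  "(x \<longlongrightarrow> x\<^sub>0) F \<Longrightarrow> ((\<lambda>A. ray_cot (turn A j) (x A)) \<longlongrightarrow> ray_cot (turn R j) x\<^sub>0) F"
  unfolding ray_cot_def using sin_pos by (intro tendsto_intros tendsto_turn) (auto simp: R_turn)

lemma tendsto_cot_sum:
  "(x \<longlongrightarrow> x\<^sub>0) F \<Longrightarrow> (y \<longlongrightarrow> y\<^sub>0) F \<Longrightarrow> ((\<lambda>A. cot_sum A j (x A) (y A)) \<longlongrightarrow> cot_sum R j x\<^sub>0 y\<^sub>0) F"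
  unfolding cot_sum_def by (intro tendsto_intros tendsto_ray_cot)

lemma tendsto_angle_area_ratio:
  "(x \<longlongrightarrow> x\<^sub>0) F \<Longrightarrow> (y \<longlongrightarrow> y\<^sub>0) F \<Longrightarrow>
    ((\<lambda>A. angle_area_ratio A j (x A) (y A)) \<longlongrightarrow> angle_area_ratio R j x\<^sub>0 y\<^sub>0) F"
  unfolding angle_area_ratio_def using R_Suc_neq[of "Suc j"]
  by (intro tendsto_intros tendsto_ray_cot tendsto_cot_sum tendsto_length) auto

lemma tendsto_signed_dist: "((\<lambda>A. signed_dist A j z) \<longlongrightarrow> signed_dist R j z) F"
  unfolding signed_dist_def by (intro tendsto_intros tendsto_edge_dir tendsto_vertex)

lemma tendsto_apex:
  assumes "(x \<longlongrightarrow> x\<^sub>0) F" "(y \<longlongrightarrow> y\<^sub>0) F" "cot_sum R j x\<^sub>0 y\<^sub>0 \<noteq> 0"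
  shows "((\<lambda>A. apex A j (x A) (y A)) \<longlongrightarrow> apex R j x\<^sub>0 y\<^sub>0) F"
  unfolding apex_def using assms
  by (intro tendsto_intros tendsto_Complex tendsto_vertex tendsto_edge_dir tendsto_ray_cot tendsto_cot_sum tendsto_length)

end

lemma (in ngon) periodic_ratio: "periodic n (angle_area_ratio A)"
  and apex_shift: "apex A (j + n) = apex A j"
  and cot_sum_shift: "cot_sum A (j + n) = cot_sum A j"
proof -
  have A: "A (Suc (Suc (i + n))) = A (Suc (Suc i))" "A (Suc (Suc (Suc (i + n)))) = A (Suc (Suc (Suc i)))" for i
    using A_shift(1)[of "Suc (Suc i)"] A_shift(1)[of "Suc (Suc (Suc i))"] by simp_all
  show "periodic n (angle_area_ratio A)"
    by (simp add: periodic_def angle_area_ratio_def cot_sum_def turn_def edge_dir_def A fun_eq_iff)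
  show "apex A (j + n) = apex A j" "cot_sum A (j + n) = cot_sum A j"
    by (simp_all add: apex_def cot_sum_def turn_def edge_dir_def A fun_eq_iff)
qed

section \<open>Existence of small systems near the regular polygon\<close>

context regular_limit
begin

text \<open>Half the apothem, which leaves room both for perturbing the polygon and for moving a
  point away from the center.\<close>

definition "radius = sin \<tau> / norm (cis \<tau> - 1) / 2"

lemma radius_pos: "0 < radius"
  unfolding radius_def using sin_pos cis_tau_neq_1 by simp

lemma eventually_deep: "eventually (\<lambda>A. deep_ngon n A radius) F"
proof -
  have "eventually (\<lambda>A. radius < signed_dist A j 0) F" for j
    by (rule order_tendstoD(1)[OF tendsto_signed_dist])
      (use radius_pos in \<open>simp add: R_signed_dist_0 radius_def\<close>)
  then have "eventually (\<lambda>A. \<forall>j\<in>{..<n}. radius < signed_dist A j 0) F"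
    by (intro eventually_ball_finite) auto
  then show ?thesis
    using eventually_ngon[of n]
  proof eventually_elim
    case (elim A)
    interpret ngon n A by (fact elim(2))
    show ?case
    proof
      fix z :: complex and j assume z: "norm z < radius"
      have "periodic n (signed_dist A)"
        by (simp add: periodic_def signed_dist_shift)
      from periodic_cong[OF this, of j "j mod n"] have "radius < signed_dist A j 0"
        using elim(1) n_pos by simp
      \<comment> \<open>A signed distance changes by at most \<open>norm z\<close> between
        \<open>0\<close> and \<open>z\<close>.\<close>
      moreover have "signed_dist A j 0 = signed_dist A j z - Im (cnj (edge_dir A j) * z)"
        by (simp add: signed_dist_def algebra_simps)
      moreover have "- Im (cnj (edge_dir A j) * z) \<le> norm z"
        using abs_Im_le_cmod[of "cnj (edge_dir A j) * z"] norm_edge_dir[of j] by (simp add: norm_mult)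
      ultimately show "0 < signed_dist A j z"
        using z by linarith
    qed
  qed
qed

lemma eventually_small_system:
  assumes "0 < \<epsilon>"
  shows "eventually (\<lambda>A. \<exists>V. normalized_system n \<epsilon> A V) F"
proof -
  \<comment> \<open>\<open>exp (- r)\<close> lies halfway between \<open>cos \<tau>\<close> and
    \<open>1\<close>, so \<open>r\<close> is positive and the cotangent sum is still positive at the
    corner of the square.\<close>
  define r where "r = - ln ((1 + cos \<tau>) / 2)"
  have exp_r: "exp (- r) = (1 + cos \<tau>) / 2"
    using cos_gt by (simp add: r_def)
  have r: "0 < r"
    using cos_gt cos_less_1 by (simp add: r_def)
  have corner: "0 < cot_sum R j (- r) r" for j
    using sin_pos cos_less_1 by (simp add: R_cot_sum exp_r)
  let ?G = "\<lambda>A. clamped r (angle_area_ratio A)"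
  have "eventually (\<lambda>A. 0 < cot_sum A j (- r) r) F" for j
    by (rule order_tendstoD(1)[OF tendsto_cot_sum corner]) (rule tendsto_const)+
  then have ev_corner: "eventually (\<lambda>A. \<forall>j\<in>{..<n}. 0 < cot_sum A j (- r) r) F"
    by (intro eventually_ball_finite) auto
  have ev_sys: "eventually (\<lambda>A. cyclic_system n (?G A) \<and> (\<forall>j. 0 < cot_sum A j (- r) r)) F"
    using ev_corner eventually_ngon[of n]
  proof eventually_elim
    case (elim A)
    interpret ngon n A by (fact elim(2))
    have "periodic n (cot_sum A)"
      by (simp add: periodic_def cot_sum_shift)
    then have "0 < cot_sum A j (- r) r" for j
      using elim(1) n_pos periodic_cong[of n "cot_sum A" j "j mod n"] by simp
    then show ?case
      using r by (intro conjI cyclic_system_angle_area_ratio n_pos periodic_ratio turn_pos A_Suc_neq) auto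
  qed
  have R_sys: "cyclic_system n (?G R)"
    using n_ge_3 r sin_pos
    by (intro cyclic_system_angle_area_ratio corner R_Suc_neq)
      (auto simp: R_turn periodic_def R_angle_area_ratio[of "_ + _"] R_angle_area_ratio[symmetric])
  have lim: "cyclic_limit F ?G (?G R)"
    unfolding cyclic_limit_def clamped_def clamp_real_def
    by (intro allI impI tendsto_intros tendsto_angle_area_ratio tendsto_max tendsto_min) auto
  have sym: "?G R j s s = ?G R 0 s s" for j s
    by (simp add: clamped_def R_angle_area_ratio[of j])
  obtain t c where sol: "eventually (\<lambda>A. cyclic_solution n (?G A) (c A) (t A) \<and> (\<Sum>j<n. t A j) = 0) F"
    and t0: "\<And>j. ((\<lambda>A. t A j) \<longlongrightarrow> 0) F"
    using solution_tendsto_0[OF eventually_mono[OF ev_sys conjunct1] R_sys lim sym] by blast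
  \<comment> \<open>As the solutions tend to \<open>0\<close>, they eventually lie where clamping
    changes nothing, and so solve the geometric equations.\<close>
  have "eventually (\<lambda>A. \<bar>t A j\<bar> < r) F" for j
    using tendstoD[OF t0 r] by (simp add: dist_real_def)
  then have ev_box: "eventually (\<lambda>A. \<forall>j\<in>{..<n}. \<bar>t A j\<bar> < r) F"
    by (intro eventually_ball_finite) auto
  have "((\<lambda>A. apex A j (t A j) (t A (Suc j))) \<longlongrightarrow> 0) F" for j
    using tendsto_apex[OF t0 t0, of j j "Suc j"] sin_pos cos_less_1 by (simp add: R_apex R_cot_sum)
  then have "eventually (\<lambda>A. norm (apex A j (t A j) (t A (Suc j))) < \<epsilon>) F" for j
    using tendstoD[OF _ assms] by fastforce
  then have ev_apex: "eventually (\<lambda>A. \<forall>j\<in>{..<n}. norm (apex A j (t A j) (t A (Suc j))) < \<epsilon>) F"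
    by (intro eventually_ball_finite) auto
  show ?thesis
    using eventually_ngon[of n] ev_sys sol ev_box ev_apex
  proof eventually_elim
    case (elim A)
    interpret ngon n A by (fact elim(1))
    have per: "periodic n (t A)"
      using elim(3) by (simp add: cyclic_solution_def)
    then have t_shift: "t A (j + n) = t A j" "t A (Suc (j + n)) = t A (Suc j)" for j
      by (simp_all add: periodic_def flip: add_Suc)
    have box: "\<bar>t A j\<bar> \<le> r" for j
      using elim(4) n_pos periodic_cong[OF per, of j "j mod n"] by (simp add: less_imp_le)
    let ?V = "\<lambda>j. apex A j (t A j) (t A (Suc j))"
    have V_per: "periodic n ?V"
      by (simp add: periodic_def apex_shift t_shift)
    \<comment> \<open>\<open>?V j\<close> is the apex of triangle \<open>Suc j\<close>, so index
      \<open>i\<close> takes the value at its predecessor modulo \<open>n\<close>.\<close>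
    have "normalized_system n \<epsilon> A (\<lambda>i. ?V (i + n - 1))"
    proof (rule normalized_system_of_solution[OF per])
      show "(\<Sum>j<n. t A j) = 0"
        using elim(3) by simp
      show "0 < cot_sum A j (t A j) (t A (Suc j))" for j
      proof -
        have "cot_sum A j (- r) r \<le> cot_sum A j (t A j) (t A (Suc j))"
          unfolding cot_sum_def using box[of j] box[of "Suc j"]
          by (intro add_mono ray_cot_mono turn_pos) auto
        then show ?thesis
          using elim(2) by (metis less_le_trans)
      qed
      show "angle_area_ratio A j (t A j) (t A (Suc j)) = c A" for j
      proof -
        have "?G A j (t A j) (t A (Suc j)) = c A"
          using elim(3) by (simp add: cyclic_solution_def)
        then show ?thesis
          by (simp add: clamped_def clamp_real_id[OF box])
      qed
      have V_shift: "?V (j + n) = ?V j" for j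
        using V_per by (simp add: periodic_def)
      have pred: "Suc (i + n - 1) = i + n" for i
        using n_pos by simp
      have "?V (i + n + n - 1) = ?V (i + n - 1)" for i
        using V_shift[of "i + n - 1"] n_pos by simp
      then show "periodic n (\<lambda>i. ?V (i + n - 1))"
        unfolding periodic_def by blast
      show "?V (Suc j + n - 1) = ?V j" for j
        using V_shift[of j] by simp
      show "norm (?V (i + n - 1)) < \<epsilon>" for i
        using elim(5) n_pos periodic_cong[OF V_per, of "i + n - 1" "(i + n - 1) mod n"] by simp
    qed
    then show ?case
      by blast
  qed
qed

end

section \<open>Coverings and cells near the regular polygon\<close>

theorem theorem4:
  fixes n :: nat
  assumes "5 \<le> n"
  shows "\<exists>\<delta>>0. \<exists>\<rho>>0.
    (\<forall>A. convex_ngon n A \<and> tuple_dist n A (regular_vertex n) < \<delta> \<longrightarrow>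
       (\<exists>!V. normalized_system n \<rho> A V) \<and>
       (\<forall>V. normalized_system n \<rho> A V \<longrightarrow>
          polygon_of n A \<subseteq> (\<Union>i\<in>{1..n}. tri A V i) \<and>
          (\<forall>p. weights n A V p \<longrightarrow>
             (\<forall>i\<in>{1..n}. convex_polygon (cell n A p i) \<and>
                cell n A p i \<subseteq> tri A V i \<and>
                closed_segment (A i) (A (Suc i)) \<subseteq> cell n A p i) \<and>
             (\<Union>i\<in>{1..n}. cell n A p i) = polygon_of n A \<and>
             (\<forall>i\<in>{1..n}. \<forall>j\<in>{1..n}. i \<noteq> j \<longrightarrow>
                interior (cell n A p i) \<inter> interior (cell n A p j) = {})))) \<and>
    (\<forall>\<epsilon>>0. \<exists>\<eta>>0. \<forall>A V. convex_ngon n A \<and>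
       tuple_dist n A (regular_vertex n) < \<delta> \<and> tuple_dist n A (regular_vertex n) < \<eta> \<and>
       normalized_system n \<rho> A V \<longrightarrow> (\<forall>i\<in>{1..n}. norm (V i) < \<epsilon>))"
proof -
  interpret regular_limit n
    using assms by unfold_locales simp
  let ?near = "\<lambda>\<delta> A. convex_ngon n A \<and> tuple_dist n A (regular_vertex n) < \<delta>"
  \<comment> \<open>\<open>\<delta>\<close> has to secure existence and also positive distances on
    the disc, from which uniqueness follows.\<close>
  have "eventually (\<lambda>A. deep_ngon n A radius \<and> (\<exists>V. normalized_system n radius A V)) F"
    using eventually_deep eventually_small_system[OF radius_pos] by (rule eventually_conj)
  then obtain \<delta> where \<delta>: "0 < \<delta>" and
    good: "\<And>A. ?near \<delta> A \<Longrightarrow> deep_ngon n A radius" "\<And>A. ?near \<delta> A \<Longrightarrow> \<exists>V. normalized_system n radius A V"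
    unfolding eventually_near_regular by blast
  show ?thesis
  proof (rule exI[of _ \<delta>], rule conjI[OF \<delta>], rule exI[of _ radius], intro conjI radius_pos)
    show "\<forall>A. ?near \<delta> A \<longrightarrow>
       (\<exists>!V. normalized_system n radius A V) \<and>
       (\<forall>V. normalized_system n radius A V \<longrightarrow>
          polygon_of n A \<subseteq> (\<Union>i\<in>{1..n}. tri A V i) \<and>
          (\<forall>p. weights n A V p \<longrightarrow>
             (\<forall>i\<in>{1..n}. convex_polygon (cell n A p i) \<and>
                cell n A p i \<subseteq> tri A V i \<and>
                closed_segment (A i) (A (Suc i)) \<subseteq> cell n A p i) \<and>
             (\<Union>i\<in>{1..n}. cell n A p i) = polygon_of n A \<and>
             (\<forall>i\<in>{1..n}. \<forall>j\<in>{1..n}. i \<noteq> j \<longrightarrow>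
                interior (cell n A p i) \<inter> interior (cell n A p j) = {})))"
    proof (intro allI impI)
      fix A assume near: "?near \<delta> A"
      interpret deep_ngon n A radius by (rule good(1)[OF near])
      have unique: "\<exists>!V. normalized_system n radius A V"
        using good(2)[OF near] normalized_system_unique by blast
      have "polygon_of n A \<subseteq> (\<Union>i\<in>{1..n}. tri A V i) \<and>
          (\<forall>p. weights n A V p \<longrightarrow>
             (\<forall>i\<in>{1..n}. convex_polygon (cell n A p i) \<and>
                cell n A p i \<subseteq> tri A V i \<and>
                closed_segment (A i) (A (Suc i)) \<subseteq> cell n A p i) \<and>
             (\<Union>i\<in>{1..n}. cell n A p i) = polygon_of n A \<and>
             (\<forall>i\<in>{1..n}. \<forall>j\<in>{1..n}. i \<noteq> j \<longrightarrow>
                interior (cell n A p i) \<inter> interior (cell n A p j) = {}))"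
        if V: "normalized_system n radius A V" for V
      proof -
        interpret normalized_ngon n A radius V by unfold_locales (fact V)
        obtain p where p: "weights n A V p" by (rule ex_weights)
        \<comment> \<open>The facts in \<open>cells\<close> share an index premise, and
          \<open>1\<close> discharges it for the covering by cells. As cells lie in triangles, the
          triangles cover too.\<close>
        have "1 \<in> {1..n}"
          using n_pos by simp
        note cover = cells(5)[OF _ this]
        have "polygon_of n A \<subseteq> (\<Union>i\<in>{1..n}. tri A V i)"
          unfolding cover[OF p, symmetric] using cells(2)[OF p] by blast
        then show ?thesis
        proof (intro conjI allI impI ballI)
          fix p i j assume "weights n A V p" "i \<in> {1..n}" "j \<in> {1..n}" "i \<noteq> j"
          then show "interior (cell n A p i) \<inter> interior (cell n A p j) = {}"
            by (rule cells(4))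
        qed (assumption | (rule cells(1-3) cover, assumption+))+
      qed
      with unique show "(\<exists>!V. normalized_system n radius A V) \<and>
       (\<forall>V. normalized_system n radius A V \<longrightarrow>
          polygon_of n A \<subseteq> (\<Union>i\<in>{1..n}. tri A V i) \<and>
          (\<forall>p. weights n A V p \<longrightarrow>
             (\<forall>i\<in>{1..n}. convex_polygon (cell n A p i) \<and>
                cell n A p i \<subseteq> tri A V i \<and>
                closed_segment (A i) (A (Suc i)) \<subseteq> cell n A p i) \<and>
             (\<Union>i\<in>{1..n}. cell n A p i) = polygon_of n A \<and>
             (\<forall>i\<in>{1..n}. \<forall>j\<in>{1..n}. i \<noteq> j \<longrightarrow>
                interior (cell n A p i) \<inter> interior (cell n A p j) = {})))"
        by blast
    qed
    show "\<forall>\<epsilon>>0. \<exists>\<eta>>0. \<forall>A V. convex_ngon n A \<and>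
       tuple_dist n A (regular_vertex n) < \<delta> \<and> tuple_dist n A (regular_vertex n) < \<eta> \<and>
       normalized_system n radius A V \<longrightarrow> (\<forall>i\<in>{1..n}. norm (V i) < \<epsilon>)"
    proof (intro allI impI)
      fix \<epsilon> :: real assume "0 < \<epsilon>"
      \<comment> \<open>A system with this bound also satisfies the bound \<open>radius\<close>, so
        uniqueness identifies it with \<open>V\<close>.\<close>
      then have "0 < min \<epsilon> radius"
        using radius_pos by simp
      from eventually_small_system[OF this] obtain \<eta> where "0 < \<eta>" and
        \<eta>: "\<And>A. ?near \<eta> A \<Longrightarrow> \<exists>V. normalized_system n (min \<epsilon> radius) A V"
        unfolding eventually_near_regular by blast
      have "norm (V i) < \<epsilon>" if near: "?near \<delta> A" "?near \<eta> A" and V: "normalized_system n radius A V" for A V i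
      proof -
        interpret deep_ngon n A radius by (rule good(1)[OF near(1)])
        obtain W where W: "normalized_system n (min \<epsilon> radius) A W"
          using \<eta>[OF near(2)] by blast
        then have "normalized_system n radius A W"
          by (auto simp: normalized_system_def)
        with V have "V = W"
          by (rule normalized_system_unique)
        with W show ?thesis
          by (simp add: normalized_system_def)
      qed
      with \<open>0 < \<eta>\<close> show "\<exists>\<eta>>0. \<forall>A V. convex_ngon n A \<and>
         tuple_dist n A (regular_vertex n) < \<delta> \<and> tuple_dist n A (regular_vertex n) < \<eta> \<and>
         normalized_system n radius A V \<longrightarrow> (\<forall>i\<in>{1..n}. norm (V i) < \<epsilon>)"
        by blast
    qed
  qed
qed

end
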